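(* A graph $G$ is a $2$-edge $n$-extremal minimal bipartite matching covered graph if and only if its partial retract $\widehat{G}$ is an edge extremal minimal bipartite matching covered graph and $\Delta(G)=3$.
   Context: All graphs are finite and loopless; parallel edges are allowed. For a graph with vertex set $V$ and edge set $E$ write $n=|V|$; $\Delta(G)$ is the maximum degree of $G$. A connected graph on four or more vertices is matching covered if every edge lies in some perfect matching. A matching covered graph is minimal if deleting any single edge yields a graph that is not matching covered. $E_2$ denotes the set of $2$-edges, i.e. edges both of whose ends have degree two. A minimal bipartite matching covered graph is $2$-edge $n$-extremal if $|E_2|=\frac{n+10}{6}$, and edge extremal if $|E|=\frac{3n-6}{2}$ (with $n$, $E_2$, $E$ referring to the graph in question). Let $v$ be a vertex of degree two of a graph $G$ with two distinct neighbours $v_1,v_2$. The bicontraction $G/v$ is obtained from $G$ by contracting the two edges $vv_1$ and $vv_2$ (all other edges are kept, so parallel edges may arise; an edge $v_1v_2$, which cannot exist in a bipartite graph, would become a loop). It is a restricted bicontraction if both $v_1$ and $v_2$ have degree at least three in $G$. The partial retract $\widehat{G}$ of $G$ is the graph obtained by repeatedly applying restricted bicontraction until it can no longer be applied (i.e. until the subgraph induced by the degree-two vertices has no isolated vertex); it is unique up to isomorphism. *)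

theory Defs
  imports Complex_Main
begin

text \<open>
  Undirected multigraphs with labelled edges; \<open>ends\<close> gives the set of ends of an edge, so that a
  loop is an edge with a singleton end set. Loops have to be representable, because contraction
  may create them; the predicate \<open>graph\<close> excludes them.
\<close>

record ('v, 'e) multigraph =
  verts :: "'v set"
  edges :: "'e set"
  ends :: "'e \<Rightarrow> 'v set"

definition graph :: "('v, 'e) multigraph \<Rightarrow> bool" where
  "graph G \<longleftrightarrow> finite (verts G) \<and> finite (edges G) \<and>
     (\<forall>e\<in>edges G. ends G e \<subseteq> verts G \<and> card (ends G e) = 2)"

text \<open>A loop contributes two to the degree.\<close>

definition degree :: "('v, 'e) multigraph \<Rightarrow> 'v \<Rightarrow> nat" where
  "degree G v = card {e \<in> edges G. v \<in> ends G e} + card {e \<in> edges G. ends G e = {v}}"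

definition max_degree :: "('v, 'e) multigraph \<Rightarrow> nat" where
  "max_degree G = Max (degree G ` verts G)"

definition adj :: "('v, 'e) multigraph \<Rightarrow> 'v \<Rightarrow> 'v \<Rightarrow> bool" where
  "adj G u v \<longleftrightarrow> (\<exists>e\<in>edges G. ends G e = {u, v})"

definition neighbours :: "('v, 'e) multigraph \<Rightarrow> 'v \<Rightarrow> 'v set" where
  "neighbours G v = {u. u \<noteq> v \<and> adj G v u}"

definition connected_graph :: "('v, 'e) multigraph \<Rightarrow> bool" where
  "connected_graph G \<longleftrightarrow> verts G \<noteq> {} \<and> (\<forall>u\<in>verts G. \<forall>v\<in>verts G. (adj G)\<^sup>*\<^sup>* u v)"

definition bipartite :: "('v, 'e) multigraph \<Rightarrow> bool" where
  "bipartite G \<longleftrightarrow> (\<exists>A B. A \<union> B = verts G \<and> A \<inter> B = {} \<and>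
     (\<forall>e\<in>edges G. \<exists>a\<in>A. \<exists>b\<in>B. ends G e = {a, b}))"

definition perfect_matching :: "('v, 'e) multigraph \<Rightarrow> 'e set \<Rightarrow> bool" where
  "perfect_matching G M \<longleftrightarrow> M \<subseteq> edges G \<and> (\<forall>v\<in>verts G. \<exists>!e. e \<in> M \<and> v \<in> ends G e)"

definition matching_covered :: "('v, 'e) multigraph \<Rightarrow> bool" where
  "matching_covered G \<longleftrightarrow> graph G \<and> connected_graph G \<and> card (verts G) \<ge> 4 \<and>
     (\<forall>e\<in>edges G. \<exists>M. perfect_matching G M \<and> e \<in> M)"

definition delete_edge :: "('v, 'e) multigraph \<Rightarrow> 'e \<Rightarrow> ('v, 'e) multigraph" where
  "delete_edge G e = G\<lparr>edges := edges G - {e}\<rparr>"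

definition minimal_matching_covered :: "('v, 'e) multigraph \<Rightarrow> bool" where
  "minimal_matching_covered G \<longleftrightarrow> matching_covered G \<and>
     (\<forall>e\<in>edges G. \<not> matching_covered (delete_edge G e))"

definition minimal_bipartite_matching_covered :: "('v, 'e) multigraph \<Rightarrow> bool" where
  "minimal_bipartite_matching_covered G \<longleftrightarrow> bipartite G \<and> minimal_matching_covered G"

definition two_edges :: "('v, 'e) multigraph \<Rightarrow> 'e set" where
  "two_edges G = {e \<in> edges G. \<forall>v\<in>ends G e. degree G v = 2}"

definition two_edge_extremal_mbmc :: "('v, 'e) multigraph \<Rightarrow> bool" where
  "two_edge_extremal_mbmc G \<longleftrightarrow> minimal_bipartite_matching_covered G \<and>
     real (card (two_edges G)) = (real (card (verts G)) + 10) / 6"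

definition edge_extremal_mbmc :: "('v, 'e) multigraph \<Rightarrow> bool" where
  "edge_extremal_mbmc G \<longleftrightarrow> minimal_bipartite_matching_covered G \<and>
     real (card (edges G)) = (3 * real (card (verts G)) - 6) / 2"

text \<open>
  In the bicontraction at \<open>v\<close>, with neighbours \<open>v1\<close> and \<open>v2\<close>, the vertex arising from
  \<open>v\<close>, \<open>v1\<close>, \<open>v2\<close> is again called \<open>v\<close>. All edges not incident with \<open>v\<close> are kept with
  their labels, so parallel edges survive and an edge between \<open>v1\<close> and \<open>v2\<close> turns into a loop
  at \<open>v\<close>.
\<close>

definition bicontraction :: "('v, 'e) multigraph \<Rightarrow> 'v \<Rightarrow> ('v, 'e) multigraph" where
  "bicontraction G v =
     \<lparr>verts = verts G - neighbours G v,
      edges = {e \<in> edges G. v \<notin> ends G e},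
      ends = (\<lambda>e. (\<lambda>x. if x \<in> neighbours G v then v else x) ` ends G e)\<rparr>"

definition bicontractible :: "('v, 'e) multigraph \<Rightarrow> 'v \<Rightarrow> bool" where
  "bicontractible G v \<longleftrightarrow> v \<in> verts G \<and> degree G v = 2 \<and> card (neighbours G v) = 2"

definition restricted_bicontraction ::
    "('v, 'e) multigraph \<Rightarrow> ('v, 'e) multigraph \<Rightarrow> bool" where
  "restricted_bicontraction G H \<longleftrightarrow>
     (\<exists>v. bicontractible G v \<and> (\<forall>u\<in>neighbours G v. degree G u \<ge> 3) \<and> H = bicontraction G v)"

text \<open>
  The partial retract is unique only up to isomorphism, so it is a relation: \<open>H\<close> is the outcome of
  some maximal sequence of restricted bicontractions starting at \<open>G\<close>.
\<close>

definition partial_retract :: "('v, 'e) multigraph \<Rightarrow> ('v, 'e) multigraph \<Rightarrow> bool" where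
  "partial_retract G H \<longleftrightarrow>
     restricted_bicontraction\<^sup>*\<^sup>* G H \<and> (\<nexists>K. restricted_bicontraction H K)"

lemma partial_retract_exists:
  assumes "finite (edges G)"
  shows "\<exists>H. partial_retract G H"
  using assms
proof (induction "card (edges G)" arbitrary: G rule: less_induct)
  case less
  show ?case
  proof (cases "\<exists>K. restricted_bicontraction G K")
    case False
    then show ?thesis by (auto simp: partial_retract_def)
  next
    case True
    then obtain v where v: "bicontractible G v"
      and step: "restricted_bicontraction G (bicontraction G v)"
      by (auto simp: restricted_bicontraction_def)
    from v have "neighbours G v \<noteq> {}" by (auto simp: bicontractible_def)
    then obtain e where "e \<in> edges G" "v \<in> ends G e" by (auto simp: neighbours_def adj_def)
    then have "edges (bicontraction G v) \<subset> edges G" by (auto simp: bicontraction_def)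
    then obtain H where "partial_retract (bicontraction G v) H"
      using less by (meson finite_subset psubset_card_mono psubset_imp_subset)
    then show ?thesis
      using step by (meson converse_rtranclp_into_rtranclp partial_retract_def)
  qed
qed

end

theory Submission
  imports Defs
begin

text \<open>
  A bipartite graph with classes \<open>A\<close>, \<open>B\<close> is matching covered iff \<open>|A| = |B|\<close> and \<open>|N(X)| > |X|\<close> for
  all nonempty proper \<open>X \<subset> A\<close>; in this form a restricted bicontraction is seen to preserve being
  minimal in both directions. It lowers the number \<open>n\<close> of vertices and the number \<open>m\<close> of edges by
  two each, the number of 2-vertices by one, and keeps the set \<open>E2\<close> of 2-edges.

  In a minimal graph every edge \<open>e = xy\<close> is the only edge from \<open>x\<close>'s colour class into some balanced
  set \<open>W\<close> that contains \<open>y\<close> but not \<open>x\<close>, and the sets \<open>W\<close> of different edges at a vertex of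
  degree at least three (a big vertex) are disjoint. Descending through such sets shows that the big
  vertices induce a disconnected forest, so that this forest has at most \<open>b - 2\<close> edges, where \<open>b\<close>
  is the number of big vertices. Counting edges at 2-vertices yields \<open>n2 - |E2| \<ge> m - n + 2\<close>.
  Moreover \<open>|N(X)| > |X|\<close>, applied to the 2-vertices on no 2-edge, bounds their number by \<open>b - 2\<close>.
  For the retract, where no such 2-vertex is left, and for \<open>G\<close> itself, these bounds and
  \<open>2m \<ge> 2 n2 + 3b\<close>, with equality iff the maximum degree is at most three, make either side of the
  equivalence force equality throughout.
\<close>

section \<open>Matching covered graphs and surplus\<close>

text \<open>The equivalence mixes two graphs: the degree condition concerns \<open>G\<close>, the
  number of edges concerns the retract, and each contraction merges two big vertices into one of
  larger degree. So the degree sum is taken in \<open>G\<close> and the forest bound in the retract;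
  they fit together because the number of contractions is exactly the number of 2-vertices of
  \<open>G\<close> on no 2-edge. Acyclicity of the big vertices alone would give at most
  \<open>b - 1\<close> edges and lead only to \<open>6 |E2| \<ge> n + 6\<close>; the constant 10
  needs a second component. It is found by an extremal choice: a largest entrance set for an edge
  from a big vertex \<open>u\<close> to a 2-vertex has a big vertex just outside it that cannot be
  reached from \<open>u\<close> through big vertices. In the backward direction nothing is known of
  \<open>G\<close> beyond being a graph, and the bipartition has to be rebuilt through the
  contractions.\<close>

definition bipartition :: "('v, 'e) multigraph \<Rightarrow> 'v set \<Rightarrow> 'v set \<Rightarrow> bool" where
  "bipartition G A B \<longleftrightarrow> finite (verts G) \<and> finite (edges G) \<and> A \<union> B = verts G \<and> A \<inter> B = {} \<and>
     (\<forall>e\<in>edges G. \<exists>a\<in>A. \<exists>b\<in>B. ends G e = {a, b})"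

definition nbhd :: "('v, 'e) multigraph \<Rightarrow> 'v set \<Rightarrow> 'v set" where
  "nbhd G X = {u. \<exists>x\<in>X. adj G x u}"

definition surplus :: "('v, 'e) multigraph \<Rightarrow> 'v set \<Rightarrow> 'v set \<Rightarrow> bool" where
  "surplus G A B \<longleftrightarrow> card A = card B \<and>
     (\<forall>X\<subseteq>A. X \<noteq> {} \<longrightarrow> X \<noteq> A \<longrightarrow> card X < card (nbhd G X))"

text \<open>The Halmos-Vaughan induction. If some proper nonempty \<open>X\<close> has exactly
  \<open>card X\<close> neighbours, then \<open>X\<close> and its complement are matched separately,
  the complement avoiding the neighbours of \<open>X\<close>. Otherwise every such set has a
  neighbour to spare, and any single pair may be fixed first.\<close>

lemma hall_marriage:
  assumes "finite A" "\<And>a. a \<in> A \<Longrightarrow> finite (N a)"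
    and "\<And>X. X \<subseteq> A \<Longrightarrow> card X \<le> card (\<Union>(N ` X))"
  shows "\<exists>f. inj_on f A \<and> (\<forall>a\<in>A. f a \<in> N a)"
  using assms
proof (induction "card A" arbitrary: A N rule: less_induct)
  case less
  note fin = less.prems(1,2) and hall = less.prems(3)
  have finU: "finite (\<Union>(N ` X))" if "X \<subseteq> A" for X
    using that fin finite_subset by blast
  show ?case
  proof (cases "\<exists>X\<subseteq>A. X \<noteq> {} \<and> X \<noteq> A \<and> card (\<Union>(N ` X)) = card X")
    case True
    then obtain X where X: "X \<subseteq> A" "X \<noteq> {}" "X \<noteq> A" "card (\<Union>(N ` X)) = card X" by blast
    have finX: "finite X" using X fin finite_subset by blast
    have "card X < card A" using X fin by (meson psubsetI psubset_card_mono)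
    then obtain f where f: "inj_on f X" "\<forall>a\<in>X. f a \<in> N a"
      using less.hyps[of X N] X fin finX hall by (metis subset_eq subset_trans)
    let ?N = "\<lambda>a. N a - \<Union>(N ` X)"
    have "card (A - X) < card A" using X fin finX
      by (metis Diff_subset Diff_disjoint inf.absorb_iff2 inf_commute order_le_imp_less_or_eq psubsetI psubset_card_mono)
    moreover have "card Y \<le> card (\<Union>(?N ` Y))" if "Y \<subseteq> A - X" for Y
    proof -
      have Y: "finite Y" "Y \<inter> X = {}" using that fin finite_subset by blast+
      \<comment> \<open>Hall's condition for \<open>Y \<union> X\<close>, minus the equality for
        \<open>X\<close>, is the condition for \<open>Y\<close> in the reduced
        neighbourhoods.\<close>
      have eq: "\<Union>(N ` (Y \<union> X)) = \<Union>(?N ` Y) \<union> \<Union>(N ` X)" by blast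
      have "card Y + card X = card (Y \<union> X)" using Y finX by (simp add: card_Un_disjoint)
      also have "\<dots> \<le> card (\<Union>(N ` (Y \<union> X)))" using that X by (intro hall) auto
      also have "\<dots> \<le> card (\<Union>(?N ` Y)) + card (\<Union>(N ` X))" unfolding eq by (rule card_Un_le)
      finally show ?thesis using X by simp
    qed
    ultimately obtain g where g: "inj_on g (A - X)" "\<forall>a\<in>A - X. g a \<in> ?N a"
      using less.hyps[of "A - X" ?N] fin by (metis (no_types, lifting) DiffD1 finite_Diff)
    define h where "h a = (if a \<in> X then f a else g a)" for a
    have "inj_on h A"
    proof (rule inj_onI)
      fix x y assume xy: "x \<in> A" "y \<in> A" "h x = h y"
      have *: "f p \<noteq> g q" if "p \<in> X" "q \<in> A - X" for p q
        using f(2) g(2) that by fastforce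
      show "x = y"
        using xy f(1) g(1) *[of x y] *[of y x] unfolding h_def
        by (auto split: if_splits dest: inj_onD)
    qed
    moreover have "\<forall>a\<in>A. h a \<in> N a" using f g by (auto simp: h_def)
    ultimately show ?thesis by blast
  next
    case False
    show ?thesis
    proof (cases "A = {}")
      case True then show ?thesis by auto
    next
      case ne: False
      then obtain a where a: "a \<in> A" by blast
      have "card {a} \<le> card (\<Union>(N ` {a}))" using a by (intro hall) auto
      then obtain b where b: "b \<in> N a" by fastforce
      let ?N = "\<lambda>x. N x - {b}"
      have "card (A - {a}) < card A" using a fin by (meson card_Diff1_less)
      moreover have "card Y \<le> card (\<Union>(?N ` Y))" if Y: "Y \<subseteq> A - {a}" for Y
      proof (cases "Y = {}")
        case False
        have "card Y \<le> card (\<Union>(N ` Y))" "card (\<Union>(N ` Y)) \<noteq> card Y"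
          using hall[of Y] Y False a \<open>\<not> (\<exists>X\<subseteq>A. _ X)\<close> by auto
        moreover have "card (\<Union>(N ` Y)) \<le> Suc (card (\<Union>(N ` Y) - {b}))"
          using finU[of Y] Y by (auto simp: card_Diff_singleton_if)
        moreover have "\<Union>(?N ` Y) = \<Union>(N ` Y) - {b}" by blast
        ultimately show ?thesis by simp
      qed simp
      ultimately obtain g where g: "inj_on g (A - {a})" "\<forall>x\<in>A - {a}. g x \<in> ?N x"
        using less.hyps[of "A - {a}" ?N] fin by (metis (no_types, lifting) DiffD1 finite_Diff)
      define h where "h x = (if x = a then b else g x)" for x
      have "inj_on h A" using g unfolding h_def inj_on_def by auto
      moreover have "\<forall>x\<in>A. h x \<in> N x" using g b by (auto simp: h_def)
      ultimately show ?thesis by blast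
    qed
  qed
qed

section \<open>Bipartitions, and perfect matchings as bijections\<close>

lemma adj_sym: "adj G x y \<Longrightarrow> adj G y x"
  by (auto simp: adj_def insert_commute)

lemma bipartition_sym: "bipartition G A B \<Longrightarrow> bipartition G B A"
  unfolding bipartition_def by (metis Int_commute Un_commute insert_commute)

lemma bipartition_ends:
  assumes "bipartition G A B" "e \<in> edges G"
  obtains a b where "a \<in> A" "b \<in> B" "ends G e = {a, b}" "a \<noteq> b"
proof -
  obtain a b where ab: "a \<in> A" "b \<in> B" "ends G e = {a, b}"
    using assms unfolding bipartition_def by blast
  moreover have "a \<noteq> b" using ab assms(1) unfolding bipartition_def by blast
  ultimately show thesis by (rule that)
qed

lemma bipartition_other_end:
  assumes bp: "bipartition G A B" and e: "e \<in> edges G" and a: "a \<in> A" "a \<in> ends G e"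
  obtains b where "b \<in> B" "ends G e = {a, b}"
proof -
  obtain x y where xy: "x \<in> A" "y \<in> B" "ends G e = {x, y}"
    by (rule bipartition_ends[OF bp e])
  moreover have "a \<noteq> y" using xy(2) a(1) bp unfolding bipartition_def by blast
  ultimately show thesis using that[of y] a(2) by simp
qed

lemma bipartition_graph:
  assumes "bipartition G A B" shows "graph G"
  unfolding graph_def
proof (intro conjI ballI)
  fix e assume "e \<in> edges G"
  then obtain a b where ab: "a \<in> A" "b \<in> B" "ends G e = {a, b}"
    using assms unfolding bipartition_def by blast
  moreover have "a \<noteq> b" using ab assms unfolding bipartition_def by blast
  ultimately show "ends G e \<subseteq> verts G" "card (ends G e) = 2"
    using assms unfolding bipartition_def by auto
qed (use assms in \<open>auto simp: bipartition_def\<close>)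

lemma bipartite_iff:
  assumes "graph G" shows "bipartite G \<longleftrightarrow> (\<exists>A B. bipartition G A B)"
  using assms unfolding bipartite_def bipartition_def graph_def by blast

lemma bipartition_finite:
  assumes "bipartition G A B" shows "finite A" "finite B"
  using assms unfolding bipartition_def by (metis finite_Un)+

lemma bipartition_adj:
  assumes "bipartition G A B" "adj G x y" shows "x \<in> A \<longleftrightarrow> y \<in> B" "x \<in> B \<longleftrightarrow> y \<in> A"
proof -
  obtain e where e: "e \<in> edges G" "ends G e = {x, y}" using assms(2) by (auto simp: adj_def)
  then obtain a b where "a \<in> A" "b \<in> B" "{x, y} = {a, b}"
    using assms(1) unfolding bipartition_def by metis
  moreover have "A \<inter> B = {}" using assms(1) by (simp add: bipartition_def)
  ultimately show "x \<in> A \<longleftrightarrow> y \<in> B" "x \<in> B \<longleftrightarrow> y \<in> A" by (auto simp: doubleton_eq_iff)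
qed

lemma nbhd_subset:
  assumes "bipartition G A B" "X \<subseteq> A" shows "nbhd G X \<subseteq> B"
  using assms bipartition_adj(1) unfolding nbhd_def by fastforce

lemma finite_nbhd:
  assumes "bipartition G A B" "X \<subseteq> A" shows "finite (nbhd G X)"
  using nbhd_subset[OF assms] bipartition_finite[OF assms(1)] finite_subset by blast

text \<open>A matching chooses edges, Hall's theorem chooses neighbours; this lemma and its converse
  pass between the two. By the third conclusion an edge of \<open>M\<close> determines the value of
  \<open>f\<close> at its end in \<open>A\<close>, so that a prescribed edge is not lost.\<close>

lemma perfect_matching_bij:
  assumes bp: "bipartition G A B" and M: "perfect_matching G M"
  obtains f where "bij_betw f A B" "\<And>a. a \<in> A \<Longrightarrow> adj G a (f a)"
    "\<And>e a b. e \<in> M \<Longrightarrow> ends G e = {a, b} \<Longrightarrow> a \<in> A \<Longrightarrow> f a = b"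
proof -
  have dis: "A \<inter> B = {}" and vs: "verts G = A \<union> B" using bp by (auto simp: bipartition_def)
  have ME: "M \<subseteq> edges G" and Mu: "\<And>v. v \<in> verts G \<Longrightarrow> \<exists>!e. e \<in> M \<and> v \<in> ends G e"
    using M by (auto simp: perfect_matching_def)
  have Me: "\<exists>e. e \<in> M \<and> v \<in> ends G e" if "v \<in> A \<union> B" for v
    using Mu that vs by (metis ex1_implies_ex)
  have Mq: "e = e'" if "v \<in> A \<union> B" "e \<in> M" "e' \<in> M" "v \<in> ends G e" "v \<in> ends G e'" for v e e'
    using Mu that vs by metis
  have "\<exists>b e. e \<in> M \<and> ends G e = {a, b} \<and> b \<in> B" if a: "a \<in> A" for a
  proof -
    obtain e where e: "e \<in> M" "a \<in> ends G e" using Me a by blast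
    moreover obtain b where "b \<in> B" "ends G e = {a, b}"
      by (rule bipartition_other_end[OF bp subsetD[OF ME e(1)] a e(2)])
    ultimately show ?thesis using e(1) by blast
  qed
  then have "\<forall>a\<in>A. \<exists>p. snd p \<in> M \<and> ends G (snd p) = {a, fst p} \<and> fst p \<in> B" by simp
  from bchoice[OF this] obtain p where
    p: "\<forall>a\<in>A. snd (p a) \<in> M \<and> ends G (snd (p a)) = {a, fst (p a)} \<and> fst (p a) \<in> B" ..
  define f g where "f a = fst (p a)" and "g a = snd (p a)" for a
  have f: "\<And>a. a \<in> A \<Longrightarrow> g a \<in> M \<and> ends G (g a) = {a, f a} \<and> f a \<in> B"
    using p unfolding f_def g_def by blast
  have u: "f a = b" if e: "e \<in> M" "ends G e = {a, b}" "a \<in> A" for e a b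
  proof -
    have "e = g a" using f[of a] e by (intro Mq[of a]) auto
    then show ?thesis using f[of a] e(2,3) dis by (auto simp: doubleton_eq_iff)
  qed
  have "inj_on f A"
  proof (rule inj_onI)
    fix x y assume xy: "x \<in> A" "y \<in> A" "f x = f y"
    have "g x = g y" using f[OF xy(1)] f[OF xy(2)] xy(3) by (intro Mq[of "f x"]) auto
    then show "x = y" using f[OF xy(1)] f[OF xy(2)] xy dis by (auto simp: doubleton_eq_iff)
  qed
  moreover have "f ` A = B"
  proof
    show "f ` A \<subseteq> B" using f by blast
    show "B \<subseteq> f ` A"
    proof
      fix b assume b: "b \<in> B"
      obtain e where e: "e \<in> M" "b \<in> ends G e" using Me b by blast
      obtain x where x: "x \<in> A" "ends G e = {b, x}"
        by (rule bipartition_other_end[OF bipartition_sym[OF bp] subsetD[OF ME e(1)] b e(2)])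
      then have "f x = b" using u[OF e(1), of x b] by (simp add: insert_commute)
      then show "b \<in> f ` A" using x(1) by blast
    qed
  qed
  ultimately have "bij_betw f A B" by (simp add: bij_betw_def)
  moreover have "adj G a (f a)" if "a \<in> A" for a
    using f[OF that] ME unfolding adj_def by blast
  ultimately show thesis using u by (rule that)
qed

lemma bij_perfect_matching:
  assumes bp: "bipartition G A B" and f: "bij_betw f A B" "\<And>a. a \<in> A \<Longrightarrow> adj G a (f a)"
    and e: "e \<in> edges G" "ends G e = {a0, f a0}" "a0 \<in> A"
  shows "\<exists>M. perfect_matching G M \<and> e \<in> M"
proof -
  have dis: "A \<inter> B = {}" and vs: "verts G = A \<union> B" using bp by (auto simp: bipartition_def)
  have "\<forall>a\<in>A. \<exists>e. e \<in> edges G \<and> ends G e = {a, f a}" using f(2) by (auto simp: adj_def)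
  then obtain g0 where g0: "\<And>a. a \<in> A \<Longrightarrow> g0 a \<in> edges G \<and> ends G (g0 a) = {a, f a}" by metis
  \<comment> \<open>\<open>f\<close> determines an edge only up to parallel copies, so at
    \<open>a0\<close> the prescribed \<open>e\<close> replaces the arbitrary choice.\<close>
  define g where "g = g0(a0 := e)"
  have g: "\<And>a. a \<in> A \<Longrightarrow> g a \<in> edges G \<and> ends G (g a) = {a, f a}"
    using g0 e by (auto simp: g_def)
  have fB: "\<And>a. a \<in> A \<Longrightarrow> f a \<in> B" using f(1) bij_betwE by blast
  have "perfect_matching G (g ` A)"
    unfolding perfect_matching_def
  proof (intro conjI ballI)
    show "g ` A \<subseteq> edges G" using g by blast
    fix v assume "v \<in> verts G"
    then consider "v \<in> A" | "v \<in> B" using vs by blast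
    then show "\<exists>!e. e \<in> g ` A \<and> v \<in> ends G e"
    proof cases
      case 1
      show ?thesis
      proof (rule ex1I[of _ "g v"])
        show "g v \<in> g ` A \<and> v \<in> ends G (g v)" using 1 g by auto
        fix e' assume "e' \<in> g ` A \<and> v \<in> ends G e'"
        then obtain x where "x \<in> A" "e' = g x" "v \<in> {x, f x}" using g by blast
        then show "e' = g v" using 1 fB dis by blast
      qed
    next
      case 2
      then obtain a where a: "a \<in> A" "f a = v" using f(1) by (metis bij_betw_def imageE)
      show ?thesis
      proof (rule ex1I[of _ "g a"])
        show "g a \<in> g ` A \<and> v \<in> ends G (g a)" using a g by auto
        fix e' assume "e' \<in> g ` A \<and> v \<in> ends G e'"
        then obtain x where x: "x \<in> A" "e' = g x" "v \<in> {x, f x}" using g by blast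
        have "x \<noteq> v" using x(1) 2 dis by blast
        then have "f x = f a" using x(3) a by simp
        then show "e' = g a" using x a f(1) by (metis bij_betw_def inj_onD)
      qed
    qed
  qed
  moreover have "e \<in> g ` A" using e(3) by (force simp: g_def)
  ultimately show ?thesis by blast
qed

lemma adj_in_verts:
  assumes "bipartition G A B" "adj G x y" shows "x \<in> verts G" "y \<in> verts G"
  using bipartition_graph[OF assms(1)] assms(2) unfolding graph_def adj_def by auto

text \<open>If \<open>X\<close> had at most \<open>card X\<close> neighbours, every perfect matching
  would map \<open>X\<close> onto \<open>nbhd G X\<close>. As each edge lies in a perfect matching,
  no edge could leave \<open>X \<union> nbhd G X\<close>, against connectedness.\<close>

lemma matching_covered_surplus:
  assumes bp: "bipartition G A B" and mc: "matching_covered G"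
  shows "surplus G A B"
proof -
  have dis: "A \<inter> B = {}" and vs: "verts G = A \<union> B" using bp by (auto simp: bipartition_def)
  have con: "connected_graph G" and n4: "card (verts G) \<ge> 4" using mc by (auto simp: matching_covered_def)
  have cover: "\<exists>f. bij_betw f A B \<and> (\<forall>a\<in>A. adj G a (f a)) \<and> f a = b" if ab: "adj G a b" "a \<in> A" for a b
  proof -
    obtain e where e: "e \<in> edges G" "ends G e = {a, b}" using ab by (auto simp: adj_def)
    then obtain M where M: "perfect_matching G M" "e \<in> M" using mc by (auto simp: matching_covered_def)
    obtain f where "bij_betw f A B" "\<And>a. a \<in> A \<Longrightarrow> adj G a (f a)"
      and f: "\<And>e a b. e \<in> M \<Longrightarrow> ends G e = {a, b} \<Longrightarrow> a \<in> A \<Longrightarrow> f a = b"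
      by (rule perfect_matching_bij[OF bp M(1)]) blast
    moreover have "f a = b" by (rule f[OF M(2) e(2) ab(2)])
    ultimately show ?thesis by blast
  qed
  have reach: "u \<in> K" if K: "x \<in> K" "x \<in> verts G" "u \<in> verts G"
      and cl: "\<And>p q. p \<in> K \<Longrightarrow> adj G p q \<Longrightarrow> q \<in> K" for x u K
  proof -
    have "(adj G)\<^sup>*\<^sup>* x u" using con K by (auto simp: connected_graph_def)
    then show ?thesis by (induction) (use K cl in auto)
  qed
  \<comment> \<open>Some edge is needed to have a perfect matching at all, and hence classes of
    equal size.\<close>
  obtain e0 where "e0 \<in> edges G"
  proof -
    obtain x where x: "x \<in> verts G" using con by (auto simp: connected_graph_def)
    have "verts G \<noteq> {x}" using n4 by auto
    then obtain u where "u \<in> verts G" "u \<noteq> x" using x by blast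
    then show thesis using reach[of x "{x}" u] x that by (auto simp: adj_def)
  qed
  then obtain a0 b0 where "a0 \<in> A" "adj G a0 b0"
    unfolding adj_def by (metis bipartition_ends[OF bp])
  then obtain f where f: "bij_betw f A B" "\<forall>a\<in>A. adj G a (f a)" using cover by blast
  have "card X < card (nbhd G X)" if X: "X \<subseteq> A" "X \<noteq> {}" "X \<noteq> A" for X
  proof (rule ccontr)
    assume "\<not> ?thesis"
    then have le: "card (nbhd G X) \<le> card X" by simp
    have im: "g ` X = nbhd G X" if g: "bij_betw g A B" "\<forall>a\<in>A. adj G a (g a)" for g
    proof (rule card_subset_eq)
      show "finite (nbhd G X)" by (rule finite_nbhd[OF bp X(1)])
      show s: "g ` X \<subseteq> nbhd G X" using g X by (auto simp: nbhd_def)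
      have "card (g ` X) = card X" using g X by (meson bij_betw_def card_image inj_on_subset)
      then show "card (g ` X) = card (nbhd G X)"
        using le card_mono[OF finite_nbhd[OF bp X(1)] s] by simp
    qed
    have closed: "q \<in> X \<union> nbhd G X" if pq: "p \<in> X \<union> nbhd G X" "adj G p q" for p q
    proof (cases "p \<in> X")
      case True then show ?thesis using pq by (auto simp: nbhd_def)
    next
      case False
      then have p: "p \<in> nbhd G X" using pq by blast
      then have "q \<in> A" using nbhd_subset[OF bp X(1)] bipartition_adj[OF bp pq(2)] by blast
      then obtain g where g: "bij_betw g A B" "\<forall>a\<in>A. adj G a (g a)" "g q = p"
        using cover adj_sym pq(2) by metis
      then obtain x where "x \<in> X" "g x = p" using im p by (metis imageE)
      then have "x = q" using g X \<open>q \<in> A\<close> by (metis bij_betw_def inj_onD subsetD)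
      then show ?thesis using \<open>x \<in> X\<close> by simp
    qed
    obtain x where x: "x \<in> X" using X by blast
    obtain u where u: "u \<in> A" "u \<notin> X" using X by blast
    have "u \<in> X \<union> nbhd G X" using reach[of x "X \<union> nbhd G X" u] x u X vs closed by blast
    then show False using u nbhd_subset[OF bp X(1)] dis by blast
  qed
  moreover have "card A = card B" using f(1) by (rule bij_betw_same_card)
  ultimately show ?thesis unfolding surplus_def by simp
qed

text \<open>Strictness leaves one spare neighbour, so Hall's condition survives when the ends of a
  prescribed edge are removed. It also yields connectedness: a component and its complement would
  both have more vertices in \<open>B\<close> than in \<open>A\<close>.\<close>

lemma surplus_matching_covered:
  assumes bp: "bipartition G A B" and sp: "surplus G A B" and n4: "card (verts G) \<ge> 4"
  shows "matching_covered G"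
proof -
  have dis: "A \<inter> B = {}" and vs: "verts G = A \<union> B" using bp by (auto simp: bipartition_def)
  have finA: "finite A" and finB: "finite B" using bipartition_finite[OF bp] .
  have AB: "card A = card B" and str: "\<And>X. X \<subseteq> A \<Longrightarrow> X \<noteq> {} \<Longrightarrow> X \<noteq> A \<Longrightarrow> card X < card (nbhd G X)"
    using sp by (auto simp: surplus_def)
  have "card A + card B \<ge> 4" using n4 vs finA finB dis by (simp add: card_Un_disjoint)
  then have A2: "card A \<ge> 2" using AB by simp
  have hasnb: "\<exists>a\<in>A. adj G a b" if "b \<in> B" for b
  proof -
    obtain a where a: "a \<in> A" using A2 by fastforce
    have "A - {a} \<noteq> {}" using A2 a by (metis Diff_eq_empty_iff card_mono card.empty card.insert empty_iff finite.emptyI finite_insert not_less_eq_eq numeral_2_eq_2)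
    then have "card (A - {a}) < card (nbhd G (A - {a}))" using a by (intro str) auto
    then have "card B \<le> card (nbhd G (A - {a}))" using a finA AB by simp
    then have "nbhd G (A - {a}) = B" using nbhd_subset[OF bp, of "A - {a}"] finB
      by (metis Diff_subset card_seteq)
    then show ?thesis using that by (auto simp: nbhd_def)
  qed
  have match: "\<exists>M. perfect_matching G M \<and> e \<in> M" if e: "e \<in> edges G" for e
  proof -
    obtain a b where ab: "a \<in> A" "b \<in> B" "ends G e = {a, b}"
      using bp e unfolding bipartition_def by blast
    let ?N = "\<lambda>x. nbhd G {x} - {b}"
    have "\<exists>f. inj_on f (A - {a}) \<and> (\<forall>x\<in>A - {a}. f x \<in> ?N x)"
    proof (rule hall_marriage)
      show "finite (A - {a})" using finA by simp
      show "finite (?N x)" if "x \<in> A - {a}" for x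
        using finite_nbhd[OF bp, of "{x}"] that by simp
      fix X assume X: "X \<subseteq> A - {a}"
      show "card X \<le> card (\<Union>(?N ` X))"
      proof (cases "X = {}")
        case False
        have eq: "\<Union>(?N ` X) = nbhd G X - {b}" by (auto simp: nbhd_def)
        have "card X < card (nbhd G X)" using False X ab by (intro str) auto
        moreover have "finite (nbhd G X)" using X by (intro finite_nbhd[OF bp]) auto
        ultimately show ?thesis unfolding eq by (auto simp: card_Diff_singleton_if)
      qed simp
    qed
    then obtain f where f: "inj_on f (A - {a})" "\<forall>x\<in>A - {a}. f x \<in> ?N x" by blast
    define h where "h = f(a := b)"
    have nb: "h x \<in> nbhd G {x}" if "x \<in> A" for x
      using f(2) that e ab by (auto simp: h_def nbhd_def adj_def)
    have inj: "inj_on h A" using f by (auto simp: h_def inj_on_def)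
    have "h ` A \<subseteq> B" using nb nbhd_subset[OF bp] by blast
    then have "h ` A = B" using inj finB AB by (simp add: card_image card_subset_eq)
    then have "bij_betw h A B" using inj by (simp add: bij_betw_def)
    then show ?thesis
      using bij_perfect_matching[OF bp, of h e a] nb e ab by (auto simp: nbhd_def h_def)
  qed
  have "(adj G)\<^sup>*\<^sup>* u v" if u: "u \<in> verts G" and v: "v \<in> verts G" for u v
  proof -
    let ?K = "{x. (adj G)\<^sup>*\<^sup>* u x}"
    have cl: "q \<in> ?K" if "p \<in> ?K" "adj G p q" for p q
      using that by (auto intro: rtranclp.rtrancl_into_rtrancl)
    have cl': "p \<in> ?K" if "q \<in> ?K" "adj G p q" for p q
      using cl[OF that(1) adj_sym[OF that(2)]] .
    have uK: "u \<in> ?K" by simp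
    have ne: "?K \<inter> A \<noteq> {}"
    proof (cases "u \<in> A")
      case False
      then obtain a where "a \<in> A" "adj G a u" using u vs hasnb by blast
      then show ?thesis using cl'[OF uK] by blast
    qed (use uK in blast)
    have "A \<subseteq> ?K"
    proof (rule ccontr)
      assume notsub: "\<not> A \<subseteq> ?K"
      have "card (?K \<inter> A) < card (nbhd G (?K \<inter> A))" using ne notsub by (intro str) auto
      moreover have "nbhd G (?K \<inter> A) \<subseteq> B \<inter> ?K"
        using nbhd_subset[OF bp, of "?K \<inter> A"] cl by (fastforce simp: nbhd_def)
      ultimately have 1: "card (A \<inter> ?K) < card (B \<inter> ?K)"
        using finB by (metis (no_types, lifting) Int_commute card_mono finite_Int le_less_trans less_le_trans)
      have "card (A - ?K) < card (nbhd G (A - ?K))" using ne notsub by (intro str) auto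
      moreover have "nbhd G (A - ?K) \<subseteq> B - ?K"
        using nbhd_subset[OF bp, of "A - ?K"] cl' by (fastforce simp: nbhd_def)
      ultimately have 2: "card (A - ?K) < card (B - ?K)"
        using finB by (meson card_mono finite_Diff less_le_trans)
      have "card A = card (A \<inter> ?K) + card (A - ?K)" "card B = card (B \<inter> ?K) + card (B - ?K)"
        using finA finB by (metis card_Int_Diff)+
      then show False using 1 2 AB by linarith
    qed
    then have "v \<in> ?K" using v vs hasnb cl by blast
    then show ?thesis by simp
  qed
  moreover have "verts G \<noteq> {}" using n4 by auto
  ultimately show ?thesis
    using bipartition_graph[OF bp] n4 match by (auto simp: matching_covered_def connected_graph_def)
qed

section \<open>Tight cuts in minimal graphs\<close>

lemma card_ge_2_obtain:
  assumes "card {e \<in> F. P e} \<noteq> 1" "e \<in> F" "P e" "finite F"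
  obtains e' where "e' \<in> F" "P e'" "e' \<noteq> e"
proof -
  have "{e \<in> F. P e} \<noteq> {e}" using assms(1) by auto
  then show thesis using that assms(2,3) by blast
qed

lemma degree_eq:
  assumes "bipartition G A B"
  shows "degree G v = card {e \<in> edges G. v \<in> ends G e}"
proof -
  have "{e \<in> edges G. ends G e = {v}} = {}"
    using bipartition_graph[OF assms] by (auto simp: graph_def)
  then have "card {e \<in> edges G. ends G e = {v}} = 0" by (metis card.empty)
  then show ?thesis unfolding degree_def by simp
qed

lemma card_nbhd_le_degree:
  assumes bp: "bipartition G A B"
  shows "card (nbhd G {v}) \<le> degree G v"
proof -
  have "\<forall>u\<in>nbhd G {v}. \<exists>e. e \<in> edges G \<and> ends G e = {v, u}"
    by (auto simp: nbhd_def adj_def)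
  from bchoice[OF this] obtain g where g: "\<forall>u\<in>nbhd G {v}. g u \<in> edges G \<and> ends G (g u) = {v, u}" ..
  have "inj_on g (nbhd G {v})"
  proof (rule inj_onI)
    fix x y assume "x \<in> nbhd G {v}" "y \<in> nbhd G {v}" "g x = g y"
    then have "{v, x} = {v, y}" using g by metis
    then show "x = y" by (auto simp: doubleton_eq_iff)
  qed
  moreover have "g ` nbhd G {v} \<subseteq> {e \<in> edges G. v \<in> ends G e}" using g by auto
  moreover have "finite {e \<in> edges G. v \<in> ends G e}" using bp by (simp add: bipartition_def)
  ultimately show ?thesis unfolding degree_eq[OF bp] by (rule card_inj_on_le)
qed

lemma matching_covered_degree_ge_2:
  assumes bp: "bipartition G A B" and mc: "matching_covered G" and v: "v \<in> verts G"
  shows "degree G v \<ge> 2"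
proof -
  have *: "degree G v \<ge> 2" if bp: "bipartition G A B" and v: "v \<in> A" for A B
  proof -
    have sp: "surplus G A B" by (rule matching_covered_surplus[OF bp mc])
    have "A \<noteq> {v}"
    proof
      assume "A = {v}"
      then have "card A + card B = 2" using sp by (simp add: surplus_def)
      moreover have "card (verts G) \<le> card A + card B"
        using bp by (metis bipartition_def card_Un_le)
      ultimately show False using mc by (simp add: matching_covered_def)
    qed
    then have "card {v} < card (nbhd G {v})" using sp v unfolding surplus_def
      by (metis empty_not_insert empty_subsetI insert_subset)
    then show ?thesis using card_nbhd_le_degree[OF bp, of v] by simp
  qed
  have "v \<in> A \<or> v \<in> B" using bp v by (auto simp: bipartition_def)
  then show ?thesis using *[OF bp] *[OF bipartition_sym[OF bp]] by blast
qed

lemma graph_other_end: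
  assumes "graph G" "e \<in> edges G" "v \<in> ends G e"
  obtains u where "ends G e = {v, u}" "u \<noteq> v"
proof -
  have "card (ends G e) = 2" using assms by (simp add: graph_def)
  then obtain x y where "ends G e = {x, y}" "x \<noteq> y" by (auto simp: card_2_iff)
  then show thesis using assms(3) that[of x] that[of y] by (auto simp: insert_commute)
qed

text \<open>
  The set \<open>W\<close> certifies that \<open>e\<close> cannot be removed: in \<open>G - e\<close> the set \<open>X = A - W\<close> has only the
  \<open>|X|\<close> neighbours \<open>B - W\<close>.
\<close>

definition entrance ::
    "('v, 'e) multigraph \<Rightarrow> 'v set \<Rightarrow> 'v set \<Rightarrow> 'v \<Rightarrow> 'e \<Rightarrow> 'v set \<Rightarrow> bool" where
  "entrance G A B x e W \<longleftrightarrow> W \<subseteq> A \<union> B \<and> card (A \<inter> W) = card (B \<inter> W) \<and> x \<in> A - W \<and> e \<in> edges G \<and>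
     (\<exists>y\<in>B \<inter> W. ends G e = {x, y}) \<and>
     (\<forall>f\<in>edges G. ends G f \<inter> (A - W) \<noteq> {} \<longrightarrow> ends G f \<inter> (B \<inter> W) \<noteq> {} \<longrightarrow> f = e)"

lemma entrance_end:
  assumes "entrance G A B x e W" "ends G e = {x, y}"
  shows "y \<in> B \<inter> W" "x \<in> A - W"
  using assms unfolding entrance_def by (auto simp: doubleton_eq_iff)

lemma entrance_unique:
  assumes "entrance G A B x e W" "f \<in> edges G" "ends G f = {a, b}" "a \<in> A - W" "b \<in> B \<inter> W"
  shows "f = e"
proof -
  have "ends G f \<inter> (A - W) \<noteq> {}" "ends G f \<inter> (B \<inter> W) \<noteq> {}" using assms(3-5) by auto
  then show ?thesis using assms(1,2) unfolding entrance_def by blast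
qed

lemma minimal_surplus:
  assumes "bipartition G A B" "minimal_matching_covered G"
  shows "surplus G A B"
  using assms matching_covered_surplus by (auto simp: minimal_matching_covered_def)

text \<open>The complement of a balanced set is balanced because \<open>card A = card B\<close>, and
  the single crossing edge is the same; so a cut found at \<open>x\<close> can be used at
  \<open>y\<close>.\<close>

lemma entrance_complement:
  assumes bp: "bipartition G A B" and sp: "surplus G A B"
    and W: "entrance G A B x e W" and e: "ends G e = {x, y}"
  shows "entrance G B A y e (verts G - W)"
proof -
  have fin: "finite A" "finite B" using bipartition_finite[OF bp] .
  have vs: "verts G = A \<union> B" using bp by (auto simp: bipartition_def)
  have eq: "B \<inter> (verts G - W) = B - W" "A \<inter> (verts G - W) = A - W"
    "B - (verts G - W) = B \<inter> W" using vs by auto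
  have "card (A - W) = card (B - W)"
    using fin W sp by (simp add: entrance_def surplus_def card_Diff_subset_Int)
  moreover have "y \<in> B \<inter> W" "x \<in> A - W" by (rule entrance_end[OF W e])+
  moreover have "ends G e = {y, x}" using e by (simp add: insert_commute)
  ultimately show ?thesis
    using W vs unfolding entrance_def eq by auto
qed

lemma bipartition_delete_edge:
  "bipartition G A B \<Longrightarrow> bipartition (delete_edge G e) A B"
  by (auto simp: bipartition_def delete_edge_def)

text \<open>\<open>delete_edge G e\<close> can fail to be matching covered only by violating surplus
  at some \<open>X\<close>. Deleting \<open>e\<close> costs at most the neighbour \<open>y\<close>,
  so \<open>X\<close> contains \<open>x\<close>, loses \<open>y\<close> and is left with exactly
  \<open>card X\<close> neighbours; \<open>W\<close> is what lies outside \<open>X\<close> and these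
  neighbours.\<close>

lemma entrance_exists:
  assumes bp: "bipartition G A B" and mn: "minimal_matching_covered G"
    and e: "e \<in> edges G" "ends G e = {x, y}" "x \<in> A"
  obtains W where "entrance G A B x e W"
proof -
  let ?H = "delete_edge G e"
  have bpH: "bipartition ?H A B" by (rule bipartition_delete_edge[OF bp])
  have sp: "surplus G A B" by (rule minimal_surplus[OF bp mn])
  have dis: "A \<inter> B = {}" and vs: "verts G = A \<union> B" using bp by (auto simp: bipartition_def)
  have yB: "y \<in> B" using bipartition_adj(1)[OF bp, of x y] e by (auto simp: adj_def)
  have "card (verts G) \<ge> 4" using mn by (simp add: minimal_matching_covered_def matching_covered_def)
  then have "card (verts ?H) \<ge> 4" by (simp add: delete_edge_def)
  moreover have "\<not> matching_covered ?H" using mn e(1) by (simp add: minimal_matching_covered_def)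
  ultimately have "\<not> surplus ?H A B" using surplus_matching_covered[OF bpH] by blast
  then obtain X where X: "X \<subseteq> A" "X \<noteq> {}" "X \<noteq> A" "card (nbhd ?H X) \<le> card X"
    using sp unfolding surplus_def by (auto simp: not_less)
  let ?N = "nbhd ?H X"
  have finN: "finite ?N" and NB: "?N \<subseteq> B" using finite_nbhd[OF bpH X(1)] nbhd_subset[OF bpH X(1)] .
  have big: "card X < card (nbhd G X)" using sp X by (simp add: surplus_def)
  have sub: "u \<in> ?N \<or> (x \<in> X \<and> u = y)" if u: "u \<in> nbhd G X" for u
  proof -
    obtain a f where f: "a \<in> X" "f \<in> edges G" "ends G f = {a, u}"
      using u by (auto simp: nbhd_def adj_def)
    show ?thesis
    proof (cases "f = e")
      case True
      then have "{a, u} = {x, y}" using f e by simp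
      moreover have "a \<noteq> y" using f X yB dis by blast
      ultimately show ?thesis using f by (auto simp: doubleton_eq_iff)
    next
      case False
      then show ?thesis using f by (auto simp: nbhd_def adj_def delete_edge_def)
    qed
  qed
  have "\<not> nbhd G X \<subseteq> ?N"
  proof
    assume "nbhd G X \<subseteq> ?N"
    then have "card (nbhd G X) \<le> card ?N" by (rule card_mono[OF finN])
    then show False using big X(4) by simp
  qed
  then obtain u where "u \<in> nbhd G X" "u \<notin> ?N" by blast
  then have xX: "x \<in> X" and yN: "y \<notin> ?N" using sub by blast+
  have "nbhd G X \<subseteq> insert y ?N" using sub by blast
  then have "card (nbhd G X) \<le> Suc (card ?N)"
    using card_mono[of "insert y ?N" "nbhd G X"] finN yN by simp
  then have cN: "card ?N = card X" using big X(4) by simp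
  define W where "W = (A - X) \<union> (B - ?N)"
  have eq: "A \<inter> W = A - X" "B \<inter> W = B - ?N" "A - W = X"
    using dis X(1) by (auto simp: W_def)
  have "entrance G A B x e W"
    unfolding entrance_def eq
  proof (intro conjI ballI impI)
    show "W \<subseteq> A \<union> B" by (auto simp: W_def)
    show "card (A - X) = card (B - ?N)"
      using sp cN X(1) NB bipartition_finite[OF bp] finN
      by (simp add: surplus_def card_Diff_subset finite_subset)
    show "x \<in> X" "e \<in> edges G" by fact+
    show "\<exists>y\<in>B - ?N. ends G e = {x, y}" using yB yN e by blast
    fix f assume f: "f \<in> edges G" and i: "ends G f \<inter> X \<noteq> {}" "ends G f \<inter> (B - ?N) \<noteq> {}"
    obtain a where a: "a \<in> X" "a \<in> ends G f" using i by blast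
    then have "a \<in> A" using X by blast
    then obtain b where b: "b \<in> B" "ends G f = {a, b}" using bipartition_other_end[OF bp f _ a(2)] by blast
    have "b \<notin> ?N" using i(2) b(2) \<open>a \<in> A\<close> dis by auto
    then have "\<not> adj ?H a b" using a(1) unfolding nbhd_def by blast
    then show "f = e" using f b(2) unfolding adj_def delete_edge_def by auto
  qed
  then show thesis by (rule that)
qed

text \<open>A parallel copy would cross the same cut, where only \<open>e\<close> is
  allowed.\<close>

lemma minimal_simple:
  assumes bp: "bipartition G A B" and mn: "minimal_matching_covered G"
    and e: "e \<in> edges G" "e' \<in> edges G" "ends G e = ends G e'"
  shows "e = e'"
proof -
  obtain x y where xy: "x \<in> A" "y \<in> B" "ends G e = {x, y}" by (rule bipartition_ends[OF bp e(1)])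
  obtain W where W: "entrance G A B x e W" by (rule entrance_exists[OF bp mn e(1) xy(3,1)])
  show ?thesis using entrance_unique[OF W e(2), of x y] entrance_end[OF W xy(3)] xy e(3) by auto
qed

lemma minimal_degree:
  assumes bp: "bipartition G A B" and mn: "minimal_matching_covered G"
  shows "degree G v = card (nbhd G {v})"
proof (rule antisym)
  have "\<forall>e\<in>{e \<in> edges G. v \<in> ends G e}. \<exists>u. ends G e = {v, u}"
  proof
    fix e assume "e \<in> {e \<in> edges G. v \<in> ends G e}"
    then have "e \<in> edges G" "v \<in> ends G e" by auto
    then obtain u where "ends G e = {v, u}" by (rule graph_other_end[OF bipartition_graph[OF bp]])
    then show "\<exists>u. ends G e = {v, u}" ..
  qed
  from bchoice[OF this] obtain h where h: "\<forall>e\<in>{e \<in> edges G. v \<in> ends G e}. ends G e = {v, h e}" ..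
  have "inj_on h {e \<in> edges G. v \<in> ends G e}"
  proof (rule inj_onI)
    fix e e' assume *: "e \<in> {e \<in> edges G. v \<in> ends G e}" "e' \<in> {e \<in> edges G. v \<in> ends G e}" "h e = h e'"
    have "ends G e = {v, h e}" "ends G e' = {v, h e'}" using h *(1,2) by blast+
    then have "ends G e = ends G e'" using *(3) by metis
    then show "e = e'" using minimal_simple[OF bp mn] *(1,2) by blast
  qed
  moreover have "h ` {e \<in> edges G. v \<in> ends G e} \<subseteq> nbhd G {v}"
    using h unfolding nbhd_def adj_def by blast
  moreover have "nbhd G {v} \<subseteq> verts G" using adj_in_verts[OF bp] unfolding nbhd_def by blast
  then have "finite (nbhd G {v})" using bp finite_subset unfolding bipartition_def by blast
  ultimately show "degree G v \<le> card (nbhd G {v})"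
    unfolding degree_eq[OF bp] by (rule card_inj_on_le)
qed (rule card_nbhd_le_degree[OF bp])

text \<open>Uncrossing of the tight sets \<open>X\<close> and \<open>X'\<close>. Their union sees
  only \<open>P \<union> P'\<close>, since the exits satisfy \<open>b \<in> P'\<close> and
  \<open>b' \<in> P\<close>. If the union were not all of \<open>A\<close>, its surplus would leave
  too few vertices in \<open>P \<inter> P'\<close> for \<open>X \<inter> X'\<close>, unless the
  latter is \<open>{x}\<close>; but then \<open>x\<close> has no neighbours except \<open>b\<close>
  and \<open>b'\<close>. Hence \<open>X \<union> X' = A\<close>, which makes \<open>W\<close> and
  \<open>W'\<close> disjoint.\<close>

lemma entrance_disjoint:
  assumes bp: "bipartition G A B" and mn: "minimal_matching_covered G"
    and W: "entrance G A B x e W" and W': "entrance G A B x e' W'"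
    and ne: "e \<noteq> e'" and deg: "degree G x \<ge> 3"
  shows "W \<inter> W' = {}"
proof -
  have sp: "surplus G A B" by (rule minimal_surplus[OF bp mn])
  have mc: "matching_covered G" using mn by (simp add: minimal_matching_covered_def)
  have dis: "A \<inter> B = {}" and vs: "verts G = A \<union> B" using bp by (auto simp: bipartition_def)
  have fin: "finite A" "finite B" using bipartition_finite[OF bp] .
  obtain b where b: "b \<in> B \<inter> W" "ends G e = {x, b}" using W by (auto simp: entrance_def)
  obtain b' where b': "b' \<in> B \<inter> W'" "ends G e' = {x, b'}" using W' by (auto simp: entrance_def)
  have x: "x \<in> A - W" "x \<in> A - W'" and ee: "e \<in> edges G" "e' \<in> edges G"
    using W W' by (auto simp: entrance_def)
  have bW': "b \<notin> W'" using entrance_unique[OF W' ee(1) b(2)] x b ne by blast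
  have b'W: "b' \<notin> W" using entrance_unique[OF W ee(2) b'(2)] x b' ne by blast
  define X X' P P' where "X = A - W" and "X' = A - W'" and "P = B - W" and "P' = B - W'"
  have nb: "u \<in> P \<or> (a = x \<and> u = b)" if au: "a \<in> X" "adj G a u" for a u
  proof (rule ccontr)
    assume *: "\<not> ?thesis"
    have "u \<in> B" using bipartition_adj[OF bp au(2)] au(1) by (auto simp: X_def)
    obtain f where f: "f \<in> edges G" "ends G f = {a, u}" using au(2) by (auto simp: adj_def)
    have "f = e" using entrance_unique[OF W f] au(1) \<open>u \<in> B\<close> * by (auto simp: X_def P_def)
    then have "{a, u} = {x, b}" using f b by simp
    then show False using * \<open>u \<in> B\<close> x dis by (auto simp: doubleton_eq_iff)
  qed
  have nb': "u \<in> P' \<or> (a = x \<and> u = b')" if au: "a \<in> X'" "adj G a u" for a u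
  proof (rule ccontr)
    assume *: "\<not> ?thesis"
    have "u \<in> B" using bipartition_adj[OF bp au(2)] au(1) by (auto simp: X'_def)
    obtain f where f: "f \<in> edges G" "ends G f = {a, u}" using au(2) by (auto simp: adj_def)
    have "f = e'" using entrance_unique[OF W' f] au(1) \<open>u \<in> B\<close> * by (auto simp: X'_def P'_def)
    then have "{a, u} = {x, b'}" using f b' by simp
    then show False using * \<open>u \<in> B\<close> x dis by (auto simp: doubleton_eq_iff)
  qed
  have cX: "card X = card P" "card X' = card P'"
    using fin W W' sp by (simp_all add: X_def P_def X'_def P'_def entrance_def surplus_def card_Diff_subset_Int)
  have finX: "finite X" "finite X'" "finite P" "finite P'"
    using fin by (auto simp: X_def P_def X'_def P'_def)
  have XA: "X \<union> X' = A"
  proof (rule ccontr)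
    assume nA: "X \<union> X' \<noteq> A"
    have "nbhd G (X \<union> X') \<subseteq> P \<union> P'"
    proof
      fix u assume "u \<in> nbhd G (X \<union> X')"
      then obtain a where "a \<in> X \<or> a \<in> X'" "adj G a u" by (auto simp: nbhd_def)
      then have "u \<in> P \<or> u \<in> P' \<or> u = b \<or> u = b'" using nb nb' by blast
      then show "u \<in> P \<union> P'" using b b' bW' b'W by (auto simp: P_def P'_def)
    qed
    then have "card (nbhd G (X \<union> X')) \<le> card (P \<union> P')" using finX by (simp add: card_mono)
    moreover have "card (X \<union> X') < card (nbhd G (X \<union> X'))"
    proof -
      have "X \<union> X' \<subseteq> A" "X \<union> X' \<noteq> {}" using x by (auto simp: X_def X'_def)
      then show ?thesis using sp nA unfolding surplus_def by blast
    qed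
    \<comment> \<open>Union and intersection have the same total size on both sides, so the excess
      of \<open>P \<union> P'\<close> over \<open>X \<union> X'\<close> is a deficit of
      \<open>P \<inter> P'\<close>.\<close>
    moreover have "card (X \<union> X') + card (X \<inter> X') = card (P \<union> P') + card (P \<inter> P')"
      using card_Un_Int[OF finX(1,2)] card_Un_Int[OF finX(3,4)] cX by simp
    ultimately have lt: "card (P \<inter> P') < card (X \<inter> X')" by simp
    \<comment> \<open>Without \<open>x\<close> the edges to \<open>b\<close> and \<open>b'\<close>
      are gone, so \<open>?Z\<close> is confined to \<open>P \<inter> P'\<close>.\<close>
    let ?Z = "X \<inter> X' - {x}"
    have xX: "x \<in> X \<inter> X'" using x by (auto simp: X_def X'_def)
    have cZ: "card (X \<inter> X') = Suc (card ?Z)" using xX finX by (simp add: card_Suc_Diff1 del: card_Diff_insert)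
    have "nbhd G ?Z \<subseteq> P \<inter> P'" using nb nb' by (auto simp: nbhd_def)
    then have "card (nbhd G ?Z) \<le> card (P \<inter> P')" using finX by (simp add: card_mono)
    then have le: "card (nbhd G ?Z) \<le> card ?Z" using lt cZ by simp
    have "?Z \<subseteq> A" "?Z \<noteq> A" using x by (auto simp: X_def)
    then have Z0: "?Z = {}" using le sp unfolding surplus_def by (meson not_le)
    have "card ?Z = 0" unfolding Z0 by simp
    then have "card (P \<inter> P') = 0" using lt cZ by linarith
    then have "P \<inter> P' = {}" using finX by simp
    have "nbhd G {x} \<subseteq> {b, b'}"
    proof
      fix u assume "u \<in> nbhd G {x}"
      then have u: "adj G x u" by (simp add: nbhd_def)
      have "u \<in> P \<or> u = b" "u \<in> P' \<or> u = b'" using nb[OF _ u] nb'[OF _ u] xX by blast+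
      then show "u \<in> {b, b'}" using \<open>P \<inter> P' = {}\<close> by blast
    qed
    then have "card (nbhd G {x}) \<le> card {b, b'}" by (intro card_mono) auto
    also have "\<dots> \<le> 2" by (simp add: card_insert_if)
    finally show False using deg minimal_degree[OF bp mn, of x] by simp
  qed
  \<comment> \<open>A common vertex in \<open>B\<close> would have a neighbour in \<open>X\<close>
    or \<open>X'\<close>, from which it can be reached only as an exit \<open>b\<close> or
    \<open>b'\<close>; but each exit lies in just one of the two sets.\<close>
  have "y \<notin> B \<inter> W \<inter> W'" for y
  proof
    assume y: "y \<in> B \<inter> W \<inter> W'"
    then have "degree G y \<ge> 2" using matching_covered_degree_ge_2[OF bp mc] vs by blast
    then have "nbhd G {y} \<noteq> {}" using minimal_degree[OF bp mn, of y] by force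
    then obtain a where "adj G y a" by (auto simp: nbhd_def)
    then have a: "adj G a y" by (rule adj_sym)
    then have "a \<in> X \<or> a \<in> X'" using bipartition_adj[OF bp a] y XA by blast
    then have "y = b \<or> y = b'" using nb[OF _ a] nb'[OF _ a] y by (auto simp: P_def P'_def)
    then show False using y bW' b'W by blast
  qed
  moreover have "W \<subseteq> A \<union> B" using W by (simp add: entrance_def)
  ultimately show ?thesis using XA by (auto simp: X_def X'_def)
qed

text \<open>Seen from \<open>y\<close>, the edge \<open>e\<close> is certified by the complement of
  \<open>W\<close>. Disjointness of the two sets at \<open>y\<close> therefore says that
  \<open>W'\<close> lies in \<open>W\<close>, and properly so because of \<open>y\<close>.\<close>

lemma entrance_nested:
  assumes bp: "bipartition G A B" and mn: "minimal_matching_covered G"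
    and W: "entrance G A B x e W" "ends G e = {x, y}"
    and W': "entrance G B A y e' W'" and "e' \<noteq> e" "degree G y \<ge> 3"
  shows "W' \<subset> W"
proof -
  have c: "entrance G B A y e (verts G - W)"
    by (rule entrance_complement[OF bp minimal_surplus[OF bp mn] W])
  have "W' \<inter> (verts G - W) = {}"
    by (rule entrance_disjoint[OF bipartition_sym[OF bp] mn W' c]) fact+
  moreover have "W' \<subseteq> verts G" using W' bp by (auto simp: entrance_def bipartition_def)
  moreover have "y \<in> W" "y \<notin> W'" using entrance_end[OF W] W' by (auto simp: entrance_def)
  ultimately show ?thesis by blast
qed

section \<open>The edges between big vertices form a forest\<close>

definition big_edges :: "('v, 'e) multigraph \<Rightarrow> 'e set" where
  "big_edges G = {e \<in> edges G. \<forall>v\<in>ends G e. degree G v \<ge> 3}"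

text \<open>If every vertex met by \<open>F\<close> lay on two edges of \<open>F\<close>, then from
  the far end \<open>y\<close> of an edge one could always continue along another edge of
  \<open>F\<close> into a strictly smaller entrance set.\<close>

lemma big_edges_leaf:
  assumes bp: "bipartition G A B" and mn: "minimal_matching_covered G"
    and F: "F \<subseteq> big_edges G" "F \<noteq> {}"
  shows "\<exists>v. card {e \<in> F. v \<in> ends G e} = 1"
proof (rule ccontr)
  assume no: "\<not> ?thesis"
  have finF: "finite F" using F(1) bp by (auto simp: big_edges_def bipartition_def intro: finite_subset)
  \<comment> \<open>The colour classes swap at each step of the descent, so they are generalised
    along with \<open>x\<close>, \<open>e\<close> and \<open>W\<close>.\<close>
  have none: False if "bipartition G A B" "entrance G A B x e W" "e \<in> F" for A B x e W
    using that
  proof (induction "card W" arbitrary: A B x e W rule: less_induct)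
    case less
    note bp = less.prems(1) and W = less.prems(2)
    obtain y where y: "ends G e = {x, y}" using W by (auto simp: entrance_def)
    obtain e' where e': "e' \<in> F" "y \<in> ends G e'" "e' \<noteq> e"
      using card_ge_2_obtain[of F "\<lambda>e. y \<in> ends G e" e] no less.prems(3) y finF by auto
    have e'E: "e' \<in> edges G" using e' F by (auto simp: big_edges_def)
    have yB: "y \<in> B" using entrance_end[OF W y] by simp
    obtain z where z: "ends G e' = {y, z}"
      by (rule bipartition_other_end[OF bipartition_sym[OF bp] e'E yB e'(2)])
    obtain W' where W': "entrance G B A y e' W'"
      by (rule entrance_exists[OF bipartition_sym[OF bp] mn e'E z yB])
    have "degree G y \<ge> 3" using F e' by (auto simp: big_edges_def)
    then have "W' \<subset> W" using entrance_nested[OF bp mn W y W' e'(3)] by simp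
    moreover have "finite W" using W bipartition_finite[OF bp] by (auto simp: entrance_def intro: finite_subset)
    ultimately show ?case using less.hyps[OF _ bipartition_sym[OF bp] W' e'(1)] by (simp add: psubset_card_mono)
  qed
  obtain e where e: "e \<in> F" using F by blast
  then have eE: "e \<in> edges G" using F by (auto simp: big_edges_def)
  obtain x y where xy: "x \<in> A" "y \<in> B" "ends G e = {x, y}" by (rule bipartition_ends[OF bp eE])
  obtain W where "entrance G A B x e W" by (rule entrance_exists[OF bp mn eE xy(3,1)])
  then show False using none[OF bp _ e] by blast
qed

text \<open>Acyclicity enters in hereditary form, as a vertex of degree one for every nonempty set
  of edges. Deleting such a vertex with its edge lowers both sides by one.\<close>

lemma card_forest:
  fixes inc :: "'e \<Rightarrow> 'v set"
  assumes "finite F" "finite V" "V \<noteq> {}" "\<And>f. f \<in> F \<Longrightarrow> inc f \<subseteq> V \<and> card (inc f) = 2"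
    and "\<And>F'. F' \<subseteq> F \<Longrightarrow> F' \<noteq> {} \<Longrightarrow> \<exists>v. card {f \<in> F'. v \<in> inc f} = 1"
  shows "card F < card V"
  using assms
proof (induction "card F" arbitrary: F V)
  case 0
  then show ?case by (simp add: card_gt_0_iff)
next
  case (Suc n)
  then have "F \<noteq> {}" by auto
  then obtain v where "card {f \<in> F. v \<in> inc f} = 1" using Suc.prems(5)[of F] by blast
  then obtain f where f: "{f \<in> F. v \<in> inc f} = {f}" by (auto simp: card_1_singleton_iff)
  then have fF: "f \<in> F" "v \<in> inc f" by auto
  have vV: "v \<in> V" using Suc.prems(4)[OF fF(1)] fF(2) by blast
  have "\<not> inc f \<subseteq> {v}" using Suc.prems(4)[OF fF(1)] card_mono[of "{v}" "inc f"] by auto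
  then have ne: "V - {v} \<noteq> {}" using Suc.prems(4)[OF fF(1)] by blast
  have "card (F - {f}) < card (V - {v})"
  proof (rule Suc.hyps(1))
    show "n = card (F - {f})" using Suc.hyps(2) fF Suc.prems(1) by simp
    show "finite (F - {f})" "finite (V - {v})" "V - {v} \<noteq> {}" using Suc.prems ne by auto
    fix g assume g: "g \<in> F - {f}"
    then have "v \<notin> inc g" using f by blast
    then show "inc g \<subseteq> V - {v} \<and> card (inc g) = 2" using Suc.prems(4)[of g] g by blast
  next
    fix F' assume "F' \<subseteq> F - {f}" "F' \<noteq> {}"
    then show "\<exists>v. card {f \<in> F'. v \<in> inc f} = 1" using Suc.prems(5)[of F'] by blast
  qed
  then show ?case using fF vV Suc.prems(1,2) by (metis card_Suc_Diff1 Suc_less_eq)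
qed

section \<open>The forest of big edges is disconnected\<close>

definition branch ::
    "('v, 'e) multigraph \<Rightarrow> 'v set \<Rightarrow> 'v set \<Rightarrow> 'v \<Rightarrow> 'e \<Rightarrow> 'v set \<Rightarrow> bool" where
  "branch G A B x e W \<longleftrightarrow> entrance G A B x e W \<or> entrance G B A x e W"

lemma branch_exists:
  assumes bp: "bipartition G A B" and mn: "minimal_matching_covered G"
    and e: "e \<in> edges G" "ends G e = {x, y}"
  obtains W where "branch G A B x e W" "y \<in> W"
proof -
  have "adj G x y" using e by (auto simp: adj_def)
  then have "x \<in> A \<or> x \<in> B" using adj_in_verts[OF bp] bp by (auto simp: bipartition_def)
  then obtain W where W: "branch G A B x e W"
    using entrance_exists[OF bp mn e] entrance_exists[OF bipartition_sym[OF bp] mn e]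
    unfolding branch_def by metis
  moreover have "y \<in> W" using W entrance_end(1)[of G _ _ x e W y] e(2) unfolding branch_def by blast
  ultimately show thesis by (rule that)
qed

text \<open>As \<open>x\<close> lies in one class only, both branches are entrances on the same
  side. Leaving the class open lets a walk be followed without recording the parity of its
  length.\<close>

lemma branch_disjoint:
  assumes bp: "bipartition G A B" and mn: "minimal_matching_covered G"
    and W: "branch G A B x e W" and W': "branch G A B x e' W'"
    and ne: "e \<noteq> e'" and deg: "degree G x \<ge> 3"
  shows "W \<inter> W' = {}"
proof -
  have side: "x \<in> A" if "entrance G A B x f V" for A B f V using that by (simp add: entrance_def)
  have dis: "x \<notin> A \<or> x \<notin> B" using bp by (auto simp: bipartition_def)
  from W[unfolded branch_def] show ?thesis
  proof
    assume w: "entrance G A B x e W"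
    then have "entrance G A B x e' W'" using W' side dis unfolding branch_def by metis
    then show ?thesis using entrance_disjoint[OF bp mn w _ ne deg] by blast
  next
    assume w: "entrance G B A x e W"
    then have "entrance G B A x e' W'" using W' side dis unfolding branch_def by metis
    then show ?thesis using entrance_disjoint[OF bipartition_sym[OF bp] mn w _ ne deg] by blast
  qed
qed

lemma branch_nested:
  assumes bp: "bipartition G A B" and mn: "minimal_matching_covered G"
    and W: "branch G A B x e W" "ends G e = {x, y}"
    and W': "branch G A B y e' W'" and ne: "e' \<noteq> e" and deg: "degree G y \<ge> 3"
  shows "W' \<subseteq> W"
proof -
  have side: "y \<in> A" if "entrance G A B y f V" for A B f V using that by (simp add: entrance_def)
  have dis: "y \<notin> A \<or> y \<notin> B" using bp by (auto simp: bipartition_def)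
  from W(1)[unfolded branch_def] show ?thesis
  proof
    assume w: "entrance G A B x e W"
    then have "y \<in> B" using entrance_end(1)[OF w W(2)] by simp
    then have "entrance G B A y e' W'" using W' side dis unfolding branch_def by metis
    then show ?thesis using entrance_nested[OF bp mn w W(2) _ ne deg] by blast
  next
    assume w: "entrance G B A x e W"
    then have "y \<in> A" using entrance_end(1)[OF w W(2)] by simp
    then have "entrance G A B y e' W'" using W' side dis unfolding branch_def by metis
    then show ?thesis using entrance_nested[OF bipartition_sym[OF bp] mn w W(2) _ ne deg] by blast
  qed
qed

text \<open>
  Walks that never traverse an edge back and forth, because branches nest only along such walks.
\<close>

inductive big_walk :: "('v, 'e) multigraph \<Rightarrow> 'v \<Rightarrow> 'v \<Rightarrow> 'e \<Rightarrow> bool" for G u where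
  start: "h \<in> big_edges G \<Longrightarrow> ends G h = {u, y} \<Longrightarrow> big_walk G u y h"
| step: "big_walk G u x g \<Longrightarrow> h \<in> big_edges G \<Longrightarrow> h \<noteq> g \<Longrightarrow> ends G h = {x, y} \<Longrightarrow> big_walk G u y h"

text \<open>The first edge differs from \<open>e\<close>, which is no big edge, so its branches at
  \<open>u\<close> miss \<open>U\<close>; afterwards branches are nested along the walk and cannot
  return to \<open>U\<close>.\<close>

lemma big_walk_avoids:
  assumes bp: "bipartition G A B" and mn: "minimal_matching_covered G"
    and U: "branch G A B u e U" "u \<notin> U" and e: "e \<notin> big_edges G" and deg: "degree G u \<ge> 3"
    and walk: "big_walk G u y h"
  shows "h \<in> big_edges G \<and> (\<exists>x. ends G h = {x, y} \<and> x \<notin> U \<and> (\<forall>W. branch G A B x h W \<longrightarrow> W \<inter> U = {}))"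
  using walk
proof induction
  case (start h y)
  then have "h \<noteq> e" using e by blast
  then have "\<forall>W. branch G A B u h W \<longrightarrow> W \<inter> U = {}"
    using branch_disjoint[OF bp mn _ U(1) _ deg] by blast
  then show ?case using start U(2) by blast
next
  case (step x g h y)
  then obtain x0 where x0: "ends G g = {x0, x}" "\<forall>W. branch G A B x0 g W \<longrightarrow> W \<inter> U = {}"
    by blast
  have gE: "g \<in> edges G" and dx: "degree G x \<ge> 3" using step.IH x0(1) by (auto simp: big_edges_def)
  obtain W0 where W0: "branch G A B x0 g W0" "x \<in> W0" by (rule branch_exists[OF bp mn gE x0(1)])
  then have "W0 \<inter> U = {}" using x0(2) by blast
  moreover have "W \<subseteq> W0" if "branch G A B x h W" for W
    by (rule branch_nested[OF bp mn W0(1) x0(1) that step.hyps(3) dx])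
  ultimately show ?case using step.hyps(2,4) W0(2) by blast
qed

text \<open>
  If an edge leaves \<open>U\<close> to a 2-vertex \<open>w\<close> with other neighbour \<open>z'\<close>, then \<open>U \<union> {w, z'}\<close> is a larger
  entrance set, unless \<open>z' \<in> U \<union> {u}\<close>, when the surplus condition leaves only \<open>w\<close> outside \<open>U\<close>
  in \<open>w\<close>'s class and \<open>u\<close> gets degree two.
\<close>

lemma maximal_entrance_exit:
  assumes bp: "bipartition G A B" and mn: "minimal_matching_covered G"
    and U: "entrance G A B u e U" and max: "\<And>W. entrance G A B u e W \<Longrightarrow> card W \<le> card U"
    and deg: "degree G u \<ge> 3"
  obtains f w z where "f \<in> edges G" "ends G f = {w, z}" "w \<in> B - U" "z \<in> A \<inter> U" "degree G w \<ge> 3"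
proof -
  have bp': "bipartition G B A" by (rule bipartition_sym[OF bp])
  have sp: "surplus G A B" and sp': "surplus G B A"
    by (rule minimal_surplus[OF bp mn], rule minimal_surplus[OF bp' mn])
  have dis: "A \<inter> B = {}" and vs: "verts G = A \<union> B" using bp by (auto simp: bipartition_def)
  have fin: "finite A" "finite B" using bipartition_finite[OF bp] .
  have UA: "U \<subseteq> A \<union> B" and cU: "card (A \<inter> U) = card (B \<inter> U)" and u: "u \<in> A - U" and eE: "e \<in> edges G"
    using U by (auto simp: entrance_def)
  obtain p where p: "p \<in> B \<inter> U" "ends G e = {u, p}" using U by (auto simp: entrance_def)
  have inU: "a \<in> U \<or> (a = u \<and> y = p)" if ya: "y \<in> B \<inter> U" "adj G y a" for y a
  proof (rule ccontr)
    assume *: "\<not> ?thesis"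
    have a: "a \<in> A" using bipartition_adj[OF bp' ya(2)] ya(1) by blast
    obtain f where f: "f \<in> edges G" "ends G f = {a, y}"
      using adj_sym[OF ya(2)] by (auto simp: adj_def)
    then have "f = e" using entrance_unique[OF U f] a * ya(1) by blast
    then have "{a, y} = {u, p}" using f(2) p(2) by simp
    then show False using * a ya(1) p dis by (auto simp: doubleton_eq_iff)
  qed
  have cAB: "card (A - U) = card (B - U)"
    using fin cU sp by (simp add: surplus_def card_Diff_subset_Int)
  have "A - U \<noteq> {}" using u by blast
  then have "card (A - U) \<noteq> 0" using fin by simp
  then have "B - U \<noteq> {}" using cAB by (metis card.empty)
  moreover have "B - U \<noteq> B" using p by blast
  \<comment> \<open>\<open>B - U\<close> is only as large as \<open>A - U\<close> but has more
    neighbours, so some edge leads from a vertex \<open>w\<close> outside \<open>U\<close> into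
    \<open>A \<inter> U\<close>.\<close>
  ultimately have "card (B - U) < card (nbhd G (B - U))" using sp' unfolding surplus_def by blast
  then have "\<not> nbhd G (B - U) \<subseteq> A - U"
    using card_mono[of "A - U" "nbhd G (B - U)"] fin cAB by auto
  then obtain z w where zw: "z \<notin> A - U" "w \<in> B - U" "adj G w z" by (auto simp: nbhd_def)
  have zA: "z \<in> A \<inter> U" using bipartition_adj[OF bp' zw(3)] zw by blast
  obtain f where f: "f \<in> edges G" "ends G f = {w, z}" using zw(3) by (auto simp: adj_def)
  have "degree G w \<ge> 2"
    using matching_covered_degree_ge_2[OF bp] mn zw(2) vs by (auto simp: minimal_matching_covered_def)
  moreover have "degree G w \<noteq> 2"
  proof
    assume "degree G w = 2"
    then have "card (nbhd G {w}) = 2" using minimal_degree[OF bp mn, of w] by simp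
    then obtain a b where ab: "nbhd G {w} = {a, b}" "a \<noteq> b" by (auto simp: card_2_iff)
    have "z \<in> nbhd G {w}" using zw(3) by (simp add: nbhd_def)
    then have "z = a \<or> z = b" using ab(1) by simp
    then obtain z' where z': "nbhd G {w} = {z, z'}" "z' \<noteq> z"
      using ab by (metis insert_commute)
    have az': "adj G w z'" using z'(1) by (auto simp: nbhd_def)
    have z'A: "z' \<in> A" using bipartition_adj[OF bp' az'] zw(2) by blast
    show False
    proof (cases "z' \<in> U \<or> z' = u")
      case False
      let ?U = "insert w (insert z' U)"
      have eq: "A \<inter> ?U = insert z' (A \<inter> U)" "B \<inter> ?U = insert w (B \<inter> U)"
        using z'A zw(2) dis by auto
      have "entrance G A B u e ?U"
        unfolding entrance_def
      proof (intro conjI ballI impI)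
        show "?U \<subseteq> A \<union> B" using UA z'A zw(2) by auto
        show "card (A \<inter> ?U) = card (B \<inter> ?U)"
          unfolding eq using cU fin False zw(2) by simp
        show "u \<in> A - ?U" using u False zw(2) dis by auto
        show "e \<in> edges G" by fact
        show "\<exists>y\<in>B \<inter> ?U. ends G e = {u, y}" using p by blast
        fix g assume g: "g \<in> edges G" and i: "ends G g \<inter> (A - ?U) \<noteq> {}" "ends G g \<inter> (B \<inter> ?U) \<noteq> {}"
        obtain a where a: "a \<in> A - ?U" "a \<in> ends G g" using i(1) by blast
        obtain b where b: "b \<in> B \<inter> ?U" "b \<in> ends G g" using i(2) by blast
        have "a \<noteq> b" using a b dis by blast
        moreover obtain c where "ends G g = {a, c}"
          using graph_other_end[OF bipartition_graph[OF bp] g a(2)] by metis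
        ultimately have g2: "ends G g = {a, b}" using b(2) by auto
        show "g = e"
        proof (cases "b = w")
          case True
          then have "a \<in> nbhd G {w}" using g g2 by (auto simp: nbhd_def adj_def insert_commute)
          then have "a = z \<or> a = z'" using z'(1) by simp
          then show ?thesis using a(1) zA by blast
        next
          case False
          then have "b \<in> B \<inter> U" "a \<in> A - U" using a b z'A dis by auto
          then show ?thesis using entrance_unique[OF U g g2] by blast
        qed
      qed
      then have "card ?U \<le> card U" by (rule max)
      moreover have "finite U" using UA fin by (meson finite_UnI finite_subset)
      moreover have "w \<noteq> z'" using z'A zw(2) dis by blast
      ultimately show False using False zw(2) by simp
    next
      case True
      let ?Y = "insert w (B \<inter> U)"
      have "nbhd G ?Y \<subseteq> insert u (A \<inter> U)"
      proof
        fix a assume a: "a \<in> nbhd G ?Y"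
        have "a \<in> A" using nbhd_subset[OF bp', of ?Y] a zw(2) by blast
        obtain y where y: "y \<in> ?Y" "adj G y a" using a by (auto simp: nbhd_def)
        show "a \<in> insert u (A \<inter> U)"
        proof (cases "y \<in> B \<inter> U")
          case t: True
          then show ?thesis using inU[OF t y(2)] \<open>a \<in> A\<close> by blast
        next
          case False
          then have "a \<in> nbhd G {w}" using y by (auto simp: nbhd_def)
          then have "a = z \<or> a = z'" using z'(1) by simp
          then show ?thesis using True zA \<open>a \<in> A\<close> by blast
        qed
      qed
      then have "card (nbhd G ?Y) \<le> card (insert u (A \<inter> U))" using fin by (simp add: card_mono)
      also have "\<dots> = card ?Y" using u zw(2) fin cU by simp
      finally have "\<not> card ?Y < card (nbhd G ?Y)" by simp
      moreover have "?Y \<subseteq> B" "?Y \<noteq> {}" using zw(2) by auto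
      ultimately have Y: "?Y = B" using sp' unfolding surplus_def by blast
      have "nbhd G {u} \<subseteq> {p, w}"
      proof
        fix y assume "y \<in> nbhd G {u}"
        then have uy: "adj G u y" by (simp add: nbhd_def)
        then have "y \<in> B" using bipartition_adj[OF bp uy] u by blast
        then have "y = w \<or> y \<in> B \<inter> U" using Y by blast
        then show "y \<in> {p, w}" using inU[of y u] adj_sym[OF uy] u by auto
      qed
      then have "card (nbhd G {u}) \<le> card {p, w}" by (intro card_mono) auto
      also have "\<dots> \<le> 2" by (simp add: card_insert_if)
      finally show False using deg minimal_degree[OF bp mn, of u] by simp
    qed
  qed
  ultimately have "degree G w \<ge> 3" by simp
  then show thesis using that f zw(2) zA by blast
qed

text \<open>A largest entrance set \<open>U\<close> of \<open>e\<close> has a big vertex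
  \<open>w\<close> outside with a neighbour \<open>z\<close> inside. If a walk reached
  \<open>w\<close> by an edge \<open>g\<close>, the branch from \<open>w\<close> towards
  \<open>z\<close> would be nested in a branch of \<open>g\<close>, which misses \<open>U\<close>
  although \<open>z\<close> lies in \<open>U\<close>.\<close>

lemma big_walk_misses:
  assumes bp: "bipartition G A B" and mn: "minimal_matching_covered G"
    and u: "u \<in> A" "degree G u \<ge> 3" and e: "e \<in> edges G" "u \<in> ends G e" "e \<notin> big_edges G"
  shows "\<exists>w\<in>verts G. degree G w \<ge> 3 \<and> w \<noteq> u \<and> (\<forall>g. \<not> big_walk G u w g)"
proof -
  have dis: "A \<inter> B = {}" and vs: "verts G = A \<union> B" using bp by (auto simp: bipartition_def)
  have fin: "finite (verts G)" using bp by (simp add: bipartition_def)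
  obtain p where p: "ends G e = {u, p}" by (rule graph_other_end[OF bipartition_graph[OF bp] e(1,2)])
  obtain W0 where W0: "entrance G A B u e W0" by (rule entrance_exists[OF bp mn e(1) p u(1)])
  have "\<forall>W. entrance G A B u e W \<longrightarrow> card W < Suc (card (verts G))"
  proof (intro allI impI)
    fix W assume "entrance G A B u e W"
    then have "W \<subseteq> verts G" using vs by (simp add: entrance_def)
    then show "card W < Suc (card (verts G))" using card_mono[OF fin] by (simp add: less_Suc_eq_le)
  qed
  from ex_has_greatest_nat[of "entrance G A B u e" W0 card "Suc (card (verts G))", OF W0 this]
  obtain U where Um: "entrance G A B u e U \<and> (\<forall>W. entrance G A B u e W \<longrightarrow> card W \<le> card U)" ..
  then have U: "entrance G A B u e U" "\<forall>W. entrance G A B u e W \<longrightarrow> card W \<le> card U" by simp_all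
  obtain f w z where f: "f \<in> edges G" "ends G f = {w, z}" "w \<in> B - U" "z \<in> A \<inter> U" "degree G w \<ge> 3"
    by (rule maximal_entrance_exit[OF bp mn U(1) mp[OF spec[OF U(2)]] u(2)])
  have br: "branch G A B u e U" using U(1) by (simp add: branch_def)
  have uU: "u \<notin> U" using U(1) by (auto simp: entrance_def)
  have "\<not> big_walk G u w g" for g
  proof
    assume "big_walk G u w g"
    then obtain x where gb: "g \<in> big_edges G" and x: "ends G g = {x, w}" "x \<notin> U"
      "\<forall>W. branch G A B x g W \<longrightarrow> W \<inter> U = {}"
      using big_walk_avoids[OF bp mn br uU e(3) u(2)] by blast
    have gE: "g \<in> edges G" using gb by (simp add: big_edges_def)
    \<comment> \<open>Nesting needs \<open>f \<noteq> g\<close>: the ends of \<open>g\<close> are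
      \<open>w\<close> and a vertex outside \<open>U\<close>, so \<open>z\<close> is not among
      them.\<close>
    have "z \<in> ends G f" using f(2) by simp
    moreover have "z \<noteq> x" "z \<noteq> w" using f x(2) by auto
    then have "z \<notin> ends G g" using x(1) by simp
    ultimately have "f \<noteq> g" by metis
    obtain W where W: "branch G A B x g W" by (rule branch_exists[OF bp mn gE x(1)])
    obtain W' where W': "branch G A B w f W'" "z \<in> W'" by (rule branch_exists[OF bp mn f(1,2)])
    have "W' \<subseteq> W" by (rule branch_nested[OF bp mn W x(1) W'(1) \<open>f \<noteq> g\<close> f(5)])
    moreover have "W \<inter> U = {}" using x(3) W by simp
    ultimately show False using W'(2) f(4) by blast
  qed
  moreover have "w \<in> verts G" "w \<noteq> u" using f(3) u(1) dis vs by auto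
  ultimately show ?thesis using f(5) by blast
qed

text \<open>The big vertices split into those reached by walks from a suitable \<open>u\<close> and
  the rest. Both parts are nonempty, no big edge joins them, and in each the forest has fewer edges
  than vertices; this accounts for the 2.\<close>

lemma card_big_edges:
  assumes bp: "bipartition G A B" and mn: "minimal_matching_covered G"
    and big: "v \<in> verts G" "degree G v \<ge> 3"
  shows "card (big_edges G) + 2 \<le> card {v \<in> verts G. degree G v \<ge> 3}"
proof -
  let ?V = "{v \<in> verts G. degree G v \<ge> 3}"
  let ?F = "big_edges G"
  have finE: "finite (edges G)" and finV: "finite ?V" using bp by (auto simp: bipartition_def)
  have FE: "?F \<subseteq> edges G" by (auto simp: big_edges_def)
  have finF: "finite ?F" using FE finE finite_subset by blast
  have endsF: "ends G f \<subseteq> ?V" "card (ends G f) = 2" if "f \<in> ?F" for f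
    using that bipartition_graph[OF bp] by (auto simp: big_edges_def graph_def)
  \<comment> \<open>A start that lies on a non-big edge: any big vertex if there are no big edges,
    otherwise a leaf of the forest, which has degree at least three but only one big edge.\<close>
  obtain u e where u: "u \<in> ?V" and e: "e \<in> edges G" "u \<in> ends G e" "e \<notin> ?F"
  proof (cases "?F = {}")
    case True
    have "{e \<in> edges G. v \<in> ends G e} \<noteq> {}"
    proof
      assume "{e \<in> edges G. v \<in> ends G e} = {}"
      then have "degree G v = 0" unfolding degree_eq[OF bp] by (metis card.empty)
      then show False using big by simp
    qed
    then show thesis using that[of v] big True by blast
  next
    case False
    obtain x where x: "card {e \<in> ?F. x \<in> ends G e} = 1"
      using big_edges_leaf[OF bp mn order_refl False] by blast
    then obtain f where "{e \<in> ?F. x \<in> ends G e} = {f}" by (auto simp: card_1_singleton_iff)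
    then have "f \<in> ?F" "x \<in> ends G f" by auto
    then have xV: "x \<in> ?V" using endsF by blast
    have "{e \<in> edges G. x \<in> ends G e} \<noteq> {e \<in> ?F. x \<in> ends G e}"
    proof
      assume "{e \<in> edges G. x \<in> ends G e} = {e \<in> ?F. x \<in> ends G e}"
      then have "degree G x = 1" unfolding degree_eq[OF bp] using x by metis
      then show False using xV by simp
    qed
    then obtain e where "e \<in> edges G" "x \<in> ends G e" "e \<notin> ?F" using FE by blast
    then show thesis using that xV by blast
  qed
  have du: "degree G u \<ge> 3" and "u \<in> A \<or> u \<in> B" using u bp by (auto simp: bipartition_def)
  from this(2) have "\<exists>w\<in>verts G. degree G w \<ge> 3 \<and> w \<noteq> u \<and> (\<forall>g. \<not> big_walk G u w g)"
    using big_walk_misses[OF bp mn _ du e] big_walk_misses[OF bipartition_sym[OF bp] mn _ du e] by (rule disjE)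
  then obtain w where w: "w \<in> ?V" "w \<noteq> u" "\<And>g. \<not> big_walk G u w g" by auto
  define K where "K = insert u {x. \<exists>g. big_walk G u x g}"
  have walkV: "x \<in> ?V" if "big_walk G u x g" for x g
    using that by cases (use endsF in auto)
  have KV: "K \<subseteq> ?V" using u walkV by (auto simp: K_def)
  have closed: "y \<in> K" if x: "x \<in> K" and h: "h \<in> ?F" "ends G h = {x, y}" for x y h
  proof (cases "x = u")
    case True
    then have "big_walk G u y h" using big_walk.start h by metis
    then show ?thesis by (auto simp: K_def)
  next
    case False
    then obtain g where g: "big_walk G u x g" using x by (auto simp: K_def)
    show ?thesis
    proof (cases "h = g")
      case False
      then have "big_walk G u y h" using big_walk.step[OF g h(1) _ h(2)] by blast
      then show ?thesis by (auto simp: K_def)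
    next
      case True
      \<comment> \<open>Turning back along \<open>g\<close> does not prolong a walk, but it leads to
        the vertex from which \<open>x\<close> was reached, and this is in \<open>K\<close>
        already.\<close>
      from g show ?thesis
      proof cases
        case start
        then have "{x, y} = {u, x}" using h True by simp
        then have "y = u" by (auto simp: doubleton_eq_iff)
        then show ?thesis by (simp add: K_def)
      next
        case (step x' g')
        then have "{x, y} = {x', x}" using h True by simp
        then have "y = x' \<or> y = x" by (auto simp: doubleton_eq_iff)
        then show ?thesis using step(1) g by (auto simp: K_def)
      qed
    qed
  qed
  define F1 F2 where "F1 = {f \<in> ?F. ends G f \<subseteq> K}" and "F2 = {f \<in> ?F. ends G f \<subseteq> ?V - K}"
  have split: "?F = F1 \<union> F2"
  proof
    show "?F \<subseteq> F1 \<union> F2"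
    proof
      fix f assume f: "f \<in> ?F"
      then have "f \<in> edges G" using FE by blast
      then obtain x y where xy: "ends G f = {x, y}" by (rule bipartition_ends[OF bp])
      have "ends G f = {y, x}" using xy by (simp add: insert_commute)
      then have "x \<in> K \<longleftrightarrow> y \<in> K" using closed[OF _ f xy] closed[OF _ f] by blast
      then show "f \<in> F1 \<union> F2" using f xy endsF(1)[OF f] by (auto simp: F1_def F2_def)
    qed
  qed (auto simp: F1_def F2_def)
  have uK: "u \<in> K" and wK: "w \<in> ?V - K" using w by (auto simp: K_def)
  have leaf: "\<exists>v. card {f \<in> F'. v \<in> ends G f} = 1" if "F' \<subseteq> ?F" "F' \<noteq> {}" for F'
    by (rule big_edges_leaf[OF bp mn that])
  have "card F1 < card K"
  proof (rule card_forest[where inc = "ends G"])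
    show "finite F1" using finF by (simp add: F1_def)
    show "finite K" using KV finV finite_subset by blast
    show "K \<noteq> {}" using uK by blast
    show "ends G f \<subseteq> K \<and> card (ends G f) = 2" if f: "f \<in> F1" for f
      using f endsF(2)[of f] by (simp add: F1_def)
    show "\<exists>v. card {f \<in> F'. v \<in> ends G f} = 1" if F': "F' \<subseteq> F1" "F' \<noteq> {}" for F'
      by (rule leaf[OF _ F'(2)]) (use F'(1) in \<open>auto simp: F1_def\<close>)
  qed
  moreover have "card F2 < card (?V - K)"
  proof (rule card_forest[where inc = "ends G"])
    show "finite F2" using finF by (simp add: F2_def)
    show "finite (?V - K)" using finV by blast
    show "?V - K \<noteq> {}" using wK by blast
    show "ends G f \<subseteq> ?V - K \<and> card (ends G f) = 2" if f: "f \<in> F2" for f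
      using f endsF(2)[of f] by (simp add: F2_def)
    show "\<exists>v. card {f \<in> F'. v \<in> ends G f} = 1" if F': "F' \<subseteq> F2" "F' \<noteq> {}" for F'
      by (rule leaf[OF _ F'(2)]) (use F'(1) in \<open>auto simp: F2_def\<close>)
  qed
  moreover have "card ?F \<le> card F1 + card F2" unfolding split by (rule card_Un_le)
  moreover have "card ?V = card K + card (?V - K)"
    using card_Int_Diff[OF finV, of K] KV by (simp add: Int_absorb1)
  ultimately show ?thesis by linarith
qed

section \<open>Degree sums and 2-vertices\<close>

lemma sum_degree:
  assumes bp: "bipartition G A B" and X: "X \<subseteq> verts G"
  shows "(\<Sum>v\<in>X. degree G v) = (\<Sum>e\<in>edges G. card (ends G e \<inter> X))"
proof -
  have fin: "finite X" "finite (edges G)" using bp X by (auto simp: bipartition_def intro: finite_subset)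
  have "(\<Sum>v\<in>X. degree G v) = (\<Sum>v\<in>X. card {e \<in> edges G. v \<in> ends G e})"
    by (simp add: degree_eq[OF bp])
  also have "\<dots> = (\<Sum>e\<in>edges G. card {v \<in> X. v \<in> ends G e})"
    by (rule sum_multicount_gen) (use fin in auto)
  also have "\<dots> = (\<Sum>e\<in>edges G. card (ends G e \<inter> X))"
    by (intro sum.cong refl arg_cong[of _ _ card]) auto
  finally show ?thesis .
qed

lemma sum_degree_verts:
  assumes bp: "bipartition G A B"
  shows "(\<Sum>v\<in>verts G. degree G v) = 2 * card (edges G)"
proof -
  have "card (ends G e \<inter> verts G) = 2" if "e \<in> edges G" for e
    using bipartition_graph[OF bp] that by (simp add: graph_def Int_absorb2)
  then show ?thesis by (simp add: sum_degree[OF bp])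
qed

lemma sum_degree_side:
  assumes bp: "bipartition G A B"
  shows "(\<Sum>v\<in>A. degree G v) = card (edges G)"
proof -
  have "card (ends G e \<inter> A) = 1" if e: "e \<in> edges G" for e
  proof -
    obtain a b where ab: "a \<in> A" "b \<in> B" "ends G e = {a, b}" by (rule bipartition_ends[OF bp e])
    then have "ends G e \<inter> A = {a}" using bp by (auto simp: bipartition_def)
    then show ?thesis by simp
  qed
  moreover have "A \<subseteq> verts G" using bp by (auto simp: bipartition_def)
  ultimately show ?thesis by (simp add: sum_degree[OF bp])
qed

definition two_verts :: "('v, 'e) multigraph \<Rightarrow> 'v set" where
  "two_verts G = {v \<in> verts G. degree G v = 2}"

text \<open>Counted edge by edge: an edge with no, one or two ends of degree two is a big edge,
  neither kind, or a 2-edge. In each case the number of these ends, plus one for a big edge, is one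
  plus one for a 2-edge.\<close>

lemma card_edges_two_verts:
  assumes bp: "bipartition G A B" and mc: "matching_covered G"
  shows "card (edges G) + card (two_edges G) = card (big_edges G) + 2 * card (two_verts G)"
proof -
  have fin: "finite (edges G)" using bp by (simp add: bipartition_def)
  let ?V = "two_verts G"
  have "2 * card ?V = (\<Sum>v\<in>?V. degree G v)" by (simp add: two_verts_def)
  also have "\<dots> = (\<Sum>e\<in>edges G. card (ends G e \<inter> ?V))"
    by (rule sum_degree[OF bp]) (auto simp: two_verts_def)
  finally have 1: "2 * card ?V = (\<Sum>e\<in>edges G. card (ends G e \<inter> ?V))" .
  have 2: "card (big_edges G) = (\<Sum>e\<in>edges G. of_bool (e \<in> big_edges G))"
    using fin by (simp add: sum_of_bool_eq big_edges_def Int_def conj_commute)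
  have 3: "card (two_edges G) = (\<Sum>e\<in>edges G. of_bool (e \<in> two_edges G))"
    using fin by (simp add: sum_of_bool_eq two_edges_def Int_def conj_commute)
  have "of_bool (e \<in> big_edges G) + card (ends G e \<inter> ?V) = 1 + (of_bool (e \<in> two_edges G) :: nat)"
    if e: "e \<in> edges G" for e
  proof -
    obtain a b where ab: "a \<in> A" "b \<in> B" "ends G e = {a, b}" "a \<noteq> b" by (rule bipartition_ends[OF bp e])
    then have v: "a \<in> verts G" "b \<in> verts G" using bp by (auto simp: bipartition_def)
    then have d: "degree G a \<ge> 2" "degree G b \<ge> 2" using matching_covered_degree_ge_2[OF bp mc] by auto
    then have "e \<in> big_edges G \<longleftrightarrow> degree G a \<noteq> 2 \<and> degree G b \<noteq> 2"
      "e \<in> two_edges G \<longleftrightarrow> degree G a = 2 \<and> degree G b = 2"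
      "ends G e \<inter> ?V = (if degree G a = 2 then {a} else {}) \<union> (if degree G b = 2 then {b} else {})"
      using e ab v by (auto simp: big_edges_def two_edges_def two_verts_def)
    then show ?thesis using ab(4) by auto
  qed
  then have "(\<Sum>e\<in>edges G. of_bool (e \<in> big_edges G) + card (ends G e \<inter> ?V)) =
      (\<Sum>e\<in>edges G. 1 + of_bool (e \<in> two_edges G))"
    by (intro sum.cong) auto
  then show ?thesis unfolding sum.distrib 1 2 3 by simp
qed

text \<open>These are the isolated vertices of the subgraph induced by the 2-vertices; in a minimal
  graph, exactly the vertices at which a restricted bicontraction is possible.\<close>

definition isolated_twos :: "('v, 'e) multigraph \<Rightarrow> 'v set" where
  "isolated_twos G = two_verts G - \<Union>(ends G ` two_edges G)"

lemma isolated_twos_neighbour: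
  assumes bp: "bipartition G A B" and mc: "matching_covered G"
    and v: "v \<in> isolated_twos G" and vy: "adj G v y"
  shows "degree G y \<ge> 3"
proof -
  obtain e where e: "e \<in> edges G" "ends G e = {v, y}" using vy by (auto simp: adj_def)
  have "degree G v = 2" "e \<notin> two_edges G" using v e by (auto simp: isolated_twos_def two_verts_def)
  then have "degree G y \<noteq> 2" using e by (auto simp: two_edges_def)
  moreover have "degree G y \<ge> 2"
    using matching_covered_degree_ge_2[OF bp mc] adj_in_verts[OF bp vy] by blast
  ultimately show ?thesis by simp
qed

text \<open>Both classes have the same size and the same degree sum, so an excess over two in
  \<open>B\<close> must reappear in \<open>A\<close>.\<close>

lemma big_on_side:
  assumes bp: "bipartition G A B" and mc: "matching_covered G"
    and b: "b \<in> B" "degree G b \<ge> 3"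
  shows "\<exists>a\<in>A. degree G a \<ge> 3"
proof (rule ccontr)
  assume no: "\<not> ?thesis"
  have vs: "verts G = A \<union> B" using bp by (simp add: bipartition_def)
  have deg: "degree G v \<ge> 2" if "v \<in> A \<union> B" for v
    using matching_covered_degree_ge_2[OF bp mc] that vs by blast
  have "degree G a = 2" if "a \<in> A" for a using deg[of a] no that by force
  then have "card (edges G) = (\<Sum>a\<in>A. 2)" using sum_degree_side[OF bp] by simp
  moreover have "(\<Sum>v\<in>B. 2) < (\<Sum>v\<in>B. degree G v)"
    by (rule sum_strict_mono_ex1) (use bipartition_finite[OF bp] deg b in \<open>auto intro!: bexI[of _ b]\<close>)
  moreover have "card A = card B" using matching_covered_surplus[OF bp mc] by (simp add: surplus_def)
  ultimately show False using sum_degree_side[OF bipartition_sym[OF bp]] by simp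
qed

text \<open>All neighbours of these vertices are big, and the big vertex \<open>a\<close> ensures
  that they are not all of \<open>A\<close>, so surplus applies. Surplus says nothing about the
  empty set, for which a big vertex in \<open>B\<close> is produced instead. The strict inequality
  on each of the two sides yields the 2 in \<open>card_isolated_twos\<close>.\<close>

lemma isolated_twos_side:
  assumes bp: "bipartition G A B" and mc: "matching_covered G"
    and a: "a \<in> A" "degree G a \<ge> 3"
  shows "card (isolated_twos G \<inter> A) < card {b \<in> B. degree G b \<ge> 3}"
proof (cases "isolated_twos G \<inter> A = {}")
  case True
  have "{b \<in> B. degree G b \<ge> 3} \<noteq> {}" using big_on_side[OF bipartition_sym[OF bp] mc a] by blast
  moreover have "card (isolated_twos G \<inter> A) = 0" unfolding True by simp
  ultimately show ?thesis using bipartition_finite[OF bp] by (simp add: card_gt_0_iff)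
next
  case False
  let ?I = "isolated_twos G \<inter> A"
  have "a \<notin> ?I" using a by (auto simp: isolated_twos_def two_verts_def)
  then have "card ?I < card (nbhd G ?I)"
    using matching_covered_surplus[OF bp mc] False a unfolding surplus_def by blast
  also have "nbhd G ?I \<subseteq> {b \<in> B. degree G b \<ge> 3}"
    using isolated_twos_neighbour[OF bp mc] nbhd_subset[OF bp, of ?I] by (auto simp: nbhd_def)
  then have "card (nbhd G ?I) \<le> card {b \<in> B. degree G b \<ge> 3}"
    using bipartition_finite[OF bp] by (intro card_mono) auto
  finally show ?thesis .
qed

lemma card_isolated_twos:
  assumes bp: "bipartition G A B" and mc: "matching_covered G"
    and v: "v \<in> verts G" "degree G v \<ge> 3"
  shows "card (isolated_twos G) + 2 \<le> card {v \<in> verts G. degree G v \<ge> 3}"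
proof -
  have vs: "verts G = A \<union> B" and dis: "A \<inter> B = {}" using bp by (auto simp: bipartition_def)
  have fin: "finite A" "finite B" using bipartition_finite[OF bp] .
  obtain a b where ab: "a \<in> A" "degree G a \<ge> 3" "b \<in> B" "degree G b \<ge> 3"
    using v vs big_on_side[OF bp mc] big_on_side[OF bipartition_sym[OF bp] mc] by blast
  let ?I = "isolated_twos G"
  have "?I \<subseteq> A \<union> B" using vs by (auto simp: isolated_twos_def two_verts_def)
  then have "?I = (?I \<inter> A) \<union> (?I \<inter> B)" by blast
  then have "card ?I \<le> card (?I \<inter> A) + card (?I \<inter> B)" by (metis card_Un_le)
  moreover have "{v \<in> verts G. degree G v \<ge> 3} = {b \<in> A. degree G b \<ge> 3} \<union> {b \<in> B. degree G b \<ge> 3}"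
    using vs by blast
  then have "card {v \<in> verts G. degree G v \<ge> 3} = card {b \<in> A. degree G b \<ge> 3} + card {b \<in> B. degree G b \<ge> 3}"
    using fin dis by (auto intro!: card_Un_disjoint)
  ultimately show ?thesis
    using isolated_twos_side[OF bp mc ab(1,2)] isolated_twos_side[OF bipartition_sym[OF bp] mc ab(3,4)]
    by linarith
qed

section \<open>Bicontraction\<close>

lemma matching_covered_iff_surplus:
  assumes bp: "bipartition G A B" and A: "card A \<ge> 2"
  shows "matching_covered G \<longleftrightarrow> surplus G A B"
proof
  assume sp: "surplus G A B"
  have "verts G = A \<union> B" "A \<inter> B = {}" using bp by (auto simp: bipartition_def)
  then have "card (verts G) = card A + card B"
    using bipartition_finite[OF bp] by (simp add: card_Un_disjoint)
  then have "card (verts G) \<ge> 4" using A sp by (simp add: surplus_def)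
  then show "matching_covered G" by (rule surplus_matching_covered[OF bp sp])
qed (rule matching_covered_surplus[OF bp])

lemma neighbours_eq_nbhd:
  assumes bp: "bipartition G A B"
  shows "neighbours G v = nbhd G {v}"
proof -
  have "u \<noteq> v" if "adj G v u" for u
  proof
    assume "u = v"
    then have "adj G v v" using that by simp
    then obtain e where "e \<in> edges G" "ends G e = {v}" by (auto simp: adj_def)
    then show False using bipartition_graph[OF bp] by (auto simp: graph_def)
  qed
  then show ?thesis by (auto simp: neighbours_def nbhd_def)
qed

text \<open>Only finiteness is assumed, so that the lemma can serve where \<open>G\<close> is not
  yet known to be bipartite.\<close>

lemma bicontractible_edges:
  assumes fin: "finite (edges G)" and v: "bicontractible G v"
  obtains v1 v2 e1 e2 where "v1 \<noteq> v2" "neighbours G v = {v1, v2}" "v1 \<noteq> v" "v2 \<noteq> v" "e1 \<noteq> e2"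
    "ends G e1 = {v, v1}" "ends G e2 = {v, v2}" "{e \<in> edges G. v \<in> ends G e} = {e1, e2}"
proof -
  have d: "degree G v = 2" and "card (neighbours G v) = 2" using v by (auto simp: bicontractible_def)
  then obtain v1 v2 where N: "neighbours G v = {v1, v2}" "v1 \<noteq> v2" by (auto simp: card_2_iff)
  have a: "v1 \<noteq> v \<and> adj G v v1" "v2 \<noteq> v \<and> adj G v v2" using N(1) unfolding neighbours_def by blast+
  then obtain e1 e2 where e: "e1 \<in> edges G" "ends G e1 = {v, v1}" "e2 \<in> edges G" "ends G e2 = {v, v2}"
    by (auto simp: adj_def)
  have "e1 \<noteq> e2" using e N(2) by (auto simp: doubleton_eq_iff)
  have "{e1, e2} = {e \<in> edges G. v \<in> ends G e}"
  proof (rule card_seteq)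
    show "finite {e \<in> edges G. v \<in> ends G e}" using fin by simp
    show "{e1, e2} \<subseteq> {e \<in> edges G. v \<in> ends G e}" using e by simp
    show "card {e \<in> edges G. v \<in> ends G e} \<le> card {e1, e2}"
      using d \<open>e1 \<noteq> e2\<close> by (simp add: degree_def)
  qed
  then show thesis using that[of v1 v2 e1 e2] N a e \<open>e1 \<noteq> e2\<close> by simp
qed

text \<open>The contracted vertex keeps the name \<open>v\<close> but stands for the neighbours of
  \<open>v\<close>, and so it changes class.\<close>

lemma bipartition_bicontraction:
  assumes bp: "bipartition G A B" and v: "v \<in> A"
  shows "bipartition (bicontraction G v) (A - {v}) (insert v (B - neighbours G v))"
proof -
  have vs: "verts G = A \<union> B" and dis: "A \<inter> B = {}" using bp by (auto simp: bipartition_def)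
  have NB: "neighbours G v \<subseteq> B" unfolding neighbours_eq_nbhd[OF bp] by (rule nbhd_subset[OF bp]) (use v in simp)
  show ?thesis
    unfolding bipartition_def
  proof (intro conjI ballI)
    show "finite (verts (bicontraction G v))" "finite (edges (bicontraction G v))"
      using bp by (simp_all add: bicontraction_def bipartition_def)
    show "A - {v} \<union> insert v (B - neighbours G v) = verts (bicontraction G v)"
      using vs NB dis v by (auto simp: bicontraction_def)
    show "(A - {v}) \<inter> insert v (B - neighbours G v) = {}" using dis by auto
    fix e assume "e \<in> edges (bicontraction G v)"
    then have e: "e \<in> edges G" "v \<notin> ends G e" by (auto simp: bicontraction_def)
    obtain a b where ab: "a \<in> A" "b \<in> B" "ends G e = {a, b}" by (rule bipartition_ends[OF bp e(1)])
    have "a \<notin> neighbours G v" "a \<noteq> v" using ab e(2) NB dis by auto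
    then have "ends (bicontraction G v) e = {a, if b \<in> neighbours G v then v else b}"
      using ab(3) by (simp add: bicontraction_def)
    then show "\<exists>a\<in>A - {v}. \<exists>b\<in>insert v (B - neighbours G v). ends (bicontraction G v) e = {a, b}"
      using ab \<open>a \<noteq> v\<close> by auto
  qed
qed

lemma nbhd_bicontraction:
  assumes bp: "bipartition G A B" and v: "v \<in> A" and X: "X \<subseteq> A - {v}"
  shows "nbhd (bicontraction G v) X = (\<lambda>x. if x \<in> neighbours G v then v else x) ` nbhd G X"
    (is "?L = ?\<phi> ` _")
proof -
  have dis: "A \<inter> B = {}" using bp by (simp add: bipartition_def)
  have NB: "neighbours G v \<subseteq> B" unfolding neighbours_eq_nbhd[OF bp] by (rule nbhd_subset[OF bp]) (use v in simp)
  have ends: "ends (bicontraction G v) e = {a, ?\<phi> b}" if "ends G e = {a, b}" "a \<in> A" for e a b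
  proof -
    have "a \<notin> neighbours G v" using that NB dis by blast
    then show ?thesis using that by (simp add: bicontraction_def)
  qed
  show ?thesis
  proof (intro equalityI subsetI)
    fix u assume "u \<in> ?L"
    then obtain x e where x: "x \<in> X" and e: "e \<in> edges G" "v \<notin> ends G e"
      and xu: "ends (bicontraction G v) e = {x, u}"
      by (auto simp: nbhd_def adj_def bicontraction_def)
    obtain a b where ab: "a \<in> A" "b \<in> B" "ends G e = {a, b}" by (rule bipartition_ends[OF bp e(1)])
    have eq: "{x, u} = {a, ?\<phi> b}" using ends[OF ab(3,1)] xu by simp
    have "x \<noteq> ?\<phi> b" using x X ab dis by auto
    then have "x = a" "u = ?\<phi> b" using eq by (auto simp: doubleton_eq_iff)
    moreover have "b \<in> nbhd G X" using e ab x \<open>x = a\<close> by (auto simp: nbhd_def adj_def)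
    ultimately show "u \<in> ?\<phi> ` nbhd G X" by blast
  next
    fix u assume "u \<in> ?\<phi> ` nbhd G X"
    then obtain b where b: "u = ?\<phi> b" "b \<in> nbhd G X" by blast
    then obtain x e where x: "x \<in> X" "e \<in> edges G" "ends G e = {x, b}" by (auto simp: nbhd_def adj_def)
    have "b \<in> B" using nbhd_subset[OF bp, of X] b X by blast
    then have "v \<notin> ends G e" using x X v dis by auto
    then have "e \<in> edges (bicontraction G v)" using x by (simp add: bicontraction_def)
    moreover have "ends (bicontraction G v) e = {x, u}" using ends[OF x(3)] x X b by auto
    ultimately show "u \<in> ?L" using x(1) by (auto simp: nbhd_def adj_def)
  qed
qed

text \<open>Merging the two neighbours \<open>M\<close> of \<open>v\<close> costs a set
  \<open>X\<close> at most one neighbour, and only if \<open>X\<close> sees both of them. Then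
  \<open>insert v X\<close> has the same neighbourhood as \<open>X\<close>, and its surplus pays for
  the loss. In the converse direction the set \<open>A - {v}\<close> is a full class of the
  contraction, about which its surplus says nothing; \<open>other\<close> serves this case.\<close>

lemma surplus_bicontraction:
  assumes bp: "bipartition G A B" and v: "v \<in> A" and N: "card (neighbours G v) = 2"
    and A: "card A \<ge> 3" and other: "\<And>u. u \<in> neighbours G v \<Longrightarrow> \<exists>a\<in>A - {v}. adj G a u"
  shows "surplus (bicontraction G v) (A - {v}) (insert v (B - neighbours G v)) \<longleftrightarrow> surplus G A B"
proof -
  define M where "M = neighbours G v"
  define \<phi> where "\<phi> x = (if x \<in> M then v else x)" for x
  have dis: "A \<inter> B = {}" using bp by (simp add: bipartition_def)
  have fin: "finite A" "finite B" using bipartition_finite[OF bp] .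
  have M: "M = nbhd G {v}" "card M = 2" using N neighbours_eq_nbhd[OF bp] by (simp_all add: M_def)
  have MB: "M \<subseteq> B" unfolding M(1) by (rule nbhd_subset[OF bp]) (use v in simp)
  have finM: "finite M" using MB fin finite_subset by blast
  have vB: "v \<notin> B" using v dis by blast
  have nb: "nbhd (bicontraction G v) X = \<phi> ` nbhd G X" if "X \<subseteq> A - {v}" for X
    using nbhd_bicontraction[OF bp v that] by (simp add: \<phi>_def[abs_def] M_def)
  have cA: "card A = Suc (card (A - {v}))" using v fin by (metis card_Suc_Diff1)
  have "card (B - M) = card B - 2" "card B \<ge> 2"
    using M(2) finM MB fin card_mono[OF fin(2) MB] by (simp_all add: card_Diff_subset)
  then have cB: "card B = Suc (card (insert v (B - M)))" using vB fin by simp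
  have phi_sub: "\<phi> ` Y \<subseteq> insert v (Y - M)" for Y by (auto simp: \<phi>_def)
  have phi_le: "card (\<phi> ` Y) \<le> Suc (card (Y - M))" if "finite Y" for Y
  proof -
    have "card (\<phi> ` Y) \<le> card (insert v (Y - M))" using that by (intro card_mono phi_sub) simp
    also have "\<dots> \<le> Suc (card (Y - M))" using that by (simp add: card_insert_if)
    finally show ?thesis .
  qed
  have finN: "finite (nbhd G X)" and NB: "nbhd G X \<subseteq> B" if "X \<subseteq> A" for X
    using finite_nbhd[OF bp that] nbhd_subset[OF bp that] by auto
  show ?thesis
    unfolding M_def[symmetric]
  proof
    assume sp: "surplus G A B"
    have str: "card X < card (nbhd G X)" if "X \<subseteq> A" "X \<noteq> {}" "X \<noteq> A" for X
      using sp that by (simp add: surplus_def)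
    have "card X < card (nbhd (bicontraction G v) X)"
      if X: "X \<subseteq> A - {v}" "X \<noteq> {}" "X \<noteq> A - {v}" for X
    proof -
      have XA: "X \<subseteq> A" "X \<noteq> A" using X v by blast+
      let ?Y = "nbhd G X"
      note fY = finN[OF XA(1)] and YB = NB[OF XA(1)]
      have vY: "v \<notin> ?Y" using YB vB by blast
      have "card X < card (\<phi> ` ?Y)"
      proof (cases "M \<subseteq> ?Y")
        case True
        have "nbhd G (insert v X) = ?Y \<union> M" by (auto simp: nbhd_def M(1))
        then have "nbhd G (insert v X) = ?Y" using True by blast
        moreover have "card (insert v X) < card (nbhd G (insert v X))"
          by (rule str) (use X v in auto)
        moreover have "card (insert v X) = Suc (card X)"
          using X fin by (subst card_insert_disjoint) (auto intro: finite_subset)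
        ultimately have lt: "Suc (card X) < card ?Y" by simp
        have "M \<noteq> {}" using M(2) by auto
        then have "insert v (?Y - M) \<subseteq> \<phi> ` ?Y"
          using True by (force simp: \<phi>_def)
        then have "card (insert v (?Y - M)) \<le> card (\<phi> ` ?Y)" using fY by (simp add: card_mono)
        moreover have "card (insert v (?Y - M)) = Suc (card ?Y - 2)"
          using vY fY True finM M(2) by (simp add: card_Diff_subset)
        ultimately show ?thesis using lt by linarith
      next
        case False
        then obtain m where m: "m \<in> M" "m \<notin> ?Y" by blast
        have "inj_on \<phi> ?Y"
        proof (rule inj_onI)
          fix x y assume xy: "x \<in> ?Y" "y \<in> ?Y" "\<phi> x = \<phi> y"
          have "M - {m} = {x}" if "x \<in> M" "x \<noteq> m" for x
            using M(2) m(1) that by (auto simp: card_2_iff)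
          then show "x = y" using xy m vY by (auto simp: \<phi>_def split: if_splits)
        qed
        then have "card (\<phi> ` ?Y) = card ?Y" by (rule card_image)
        then show ?thesis using str[OF XA(1) X(2) XA(2)] by simp
      qed
      then show ?thesis using nb[OF X(1)] by simp
    qed
    moreover have "card (A - {v}) = card (insert v (B - M))" using sp cA cB by (simp add: surplus_def)
    ultimately show "surplus (bicontraction G v) (A - {v}) (insert v (B - M))"
      by (simp add: surplus_def)
  next
    assume sp: "surplus (bicontraction G v) (A - {v}) (insert v (B - M))"
    have str: "card X < card (\<phi> ` nbhd G X)" if "X \<subseteq> A - {v}" "X \<noteq> {}" "X \<noteq> A - {v}" for X
      unfolding nb[OF that(1), symmetric] using sp that unfolding surplus_def by blast
    have AB: "card A = card B" using sp cA cB by (simp add: surplus_def)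
    have "card X < card (nbhd G X)" if X: "X \<subseteq> A" "X \<noteq> {}" "X \<noteq> A" for X
    proof (cases "v \<in> X")
      case False
      then have XA: "X \<subseteq> A - {v}" using X by blast
      show ?thesis
      proof (cases "X = A - {v}")
        case False
        have "card X < card (\<phi> ` nbhd G X)" by (rule str[OF XA X(2) False])
        also have "\<dots> \<le> card (nbhd G X)" by (rule card_image_le[OF finN[OF X(1)]])
        finally show ?thesis .
      next
        case True
        \<comment> \<open>Leaving out one more vertex \<open>a\<close> gives a set to which surplus
          applies, nonempty by \<open>card A \<ge> 3\<close>; it already sees the whole other class
          of the contraction.\<close>
        obtain a where a: "a \<in> A - {v}" using True X by blast
        let ?X = "A - {v} - {a}"
        have c: "card (A - {v}) = Suc (card ?X)" using a fin by (metis card_Suc_Diff1 finite_Diff)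
        have "?X \<noteq> {}"
        proof
          assume "?X = {}"
          then have "card ?X = 0" by (metis card.empty)
          then show False using c cA A by simp
        qed
        then have "card ?X < card (\<phi> ` nbhd G ?X)" by (intro str) (use a in auto)
        then have "card (insert v (B - M)) \<le> card (\<phi> ` nbhd G ?X)" using c cA cB AB by simp
        moreover have "\<phi> ` nbhd G ?X \<subseteq> insert v (B - M)"
          using phi_sub[of "nbhd G ?X"] NB[of ?X] by blast
        ultimately have eq: "\<phi> ` nbhd G ?X = insert v (B - M)" using fin by (intro card_seteq) auto
        have "B \<subseteq> nbhd G X"
        proof
          fix b assume b: "b \<in> B"
          show "b \<in> nbhd G X"
          proof (cases "b \<in> M")
            case t: True
            then show ?thesis using other[of b] True by (auto simp: M_def nbhd_def)
          next
            case False
            then have "b \<in> \<phi> ` nbhd G ?X" using eq b by blast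
            then obtain y where "y \<in> nbhd G ?X" "b = \<phi> y" by blast
            then have "b \<in> nbhd G ?X" using b vB by (auto simp: \<phi>_def split: if_splits)
            then show ?thesis using True by (auto simp: nbhd_def)
          qed
        qed
        then have "card B \<le> card (nbhd G X)" by (rule card_mono[OF finN[OF X(1)]])
        then show ?thesis using True cA AB by simp
      qed
    next
      case True
      \<comment> \<open>Dropping \<open>v\<close> lowers \<open>card X\<close> by one, while
        \<open>M\<close> adds two vertices to \<open>nbhd G X\<close> and at most one to the image
        of \<open>nbhd G ?X\<close>.\<close>
      let ?X = "X - {v}"
      have cX: "card X = Suc (card ?X)" using True X fin by (metis card_Suc_Diff1 finite_subset)
      have nX: "nbhd G X = nbhd G ?X \<union> M" using True by (auto simp: nbhd_def M(1))
      have f: "finite (nbhd G ?X)" using finN[of ?X] X by blast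
      have eq: "nbhd G X = (nbhd G ?X - M) \<union> M" using nX by blast
      have "card ((nbhd G ?X - M) \<union> M) = card (nbhd G ?X - M) + card M"
        by (rule card_Un_disjoint) (use f finM in auto)
      then have cn: "card (nbhd G X) = card (nbhd G ?X - M) + 2" by (simp only: eq[symmetric] M(2))
      show ?thesis
      proof (cases "?X = {}")
        case True
        then have "card ?X = 0" by (metis card.empty)
        then show ?thesis using cX cn by simp
      next
        case False
        have "?X \<noteq> A - {v}" using X True v by blast
        then have "card ?X < card (\<phi> ` nbhd G ?X)" using X False by (intro str) auto
        then show ?thesis using phi_le[OF f] cX cn by simp
      qed
    qed
    then show "surplus G A B" using AB by (simp add: surplus_def)
  qed
qed

section \<open>Minimality under bicontraction\<close>

lemma delete_edge_sel [simp]: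
  "verts (delete_edge G e) = verts G" "edges (delete_edge G e) = edges G - {e}"
  "ends (delete_edge G e) = ends G"
  by (simp_all add: delete_edge_def)

lemma neighbours_delete_edge:
  assumes "v \<notin> ends G e"
  shows "neighbours (delete_edge G e) v = neighbours G v"
  using assms by (auto simp: neighbours_def adj_def)

lemma bicontraction_delete_edge:
  assumes "v \<notin> ends G e"
  shows "bicontraction (delete_edge G e) v = delete_edge (bicontraction G v) e"
  using neighbours_delete_edge[OF assms] by (auto simp: bicontraction_def delete_edge_def)

text \<open>Away from \<open>v\<close>, deleting an edge commutes with contracting, and a neighbour
  of \<open>v\<close> of degree at least three keeps an edge to \<open>A - {v}\<close> after the
  deletion, so the surplus equivalence also applies to \<open>delete_edge G e\<close>. Deleting one
  of the two edges at \<open>v\<close> leaves a vertex of degree one, so these edges never spoil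
  minimality.\<close>

lemma minimal_bicontraction:
  assumes bp: "bipartition G A B" and v: "v \<in> A" "bicontractible G v" and A: "card A \<ge> 3"
    and big: "\<And>u. u \<in> neighbours G v \<Longrightarrow> degree G u \<ge> 3"
  shows "minimal_matching_covered (bicontraction G v) \<longleftrightarrow> minimal_matching_covered G"
proof -
  let ?H = "bicontraction G v"
  let ?A = "A - {v}" and ?B = "insert v (B - neighbours G v)"
  have bpH: "bipartition ?H ?A ?B" by (rule bipartition_bicontraction[OF bp v(1)])
  have fin: "finite A" "finite (edges G)" using bipartition_finite[OF bp] bp by (auto simp: bipartition_def)
  have cA: "card ?A \<ge> 2" "card A \<ge> 2" using A v fin by auto
  have cN: "card (neighbours G v) = 2" using v(2) by (simp add: bicontractible_def)
  obtain v1 v2 e1 e2 where ve: "v1 \<noteq> v2" "neighbours G v = {v1, v2}" "v1 \<noteq> v" "v2 \<noteq> v" "e1 \<noteq> e2"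
    "ends G e1 = {v, v1}" "ends G e2 = {v, v2}" "{e \<in> edges G. v \<in> ends G e} = {e1, e2}"
    by (rule bicontractible_edges[OF fin(2) v(2)])
  have NB: "neighbours G v \<subseteq> B" unfolding neighbours_eq_nbhd[OF bp] by (rule nbhd_subset[OF bp]) (use v in simp)
  have other: "\<exists>a\<in>A - {v}. \<exists>f\<in>edges G. f \<noteq> e \<and> ends G f = {a, u}"
    if u: "u \<in> neighbours G v" for u e
  proof -
    \<comment> \<open>\<open>e'\<close> is the edge joining \<open>u\<close> to \<open>v\<close>; of
      at least three edges at \<open>u\<close>, one is neither \<open>e\<close> nor
      \<open>e'\<close>.\<close>
    obtain e' where e': "{e \<in> edges G. v \<in> ends G e} \<inter> {e. u \<in> ends G e} \<subseteq> {e'}"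
      using ve u by auto
    have "card {e, e'} < card {f \<in> edges G. u \<in> ends G f}"
      using big[OF u] degree_eq[OF bp, of u] card_insert_le_m1[of 2 "{e'}" e]
      by (simp add: card_insert_if split: if_splits)
    then have "\<not> {f \<in> edges G. u \<in> ends G f} \<subseteq> {e, e'}"
      by (meson card_mono finite.emptyI finite_insert not_less)
    then obtain f where f: "f \<in> edges G" "u \<in> ends G f" "f \<noteq> e" "f \<noteq> e'" by blast
    have vf: "v \<notin> ends G f" using e' f by blast
    have uB: "u \<in> B" using u NB by blast
    obtain a where a: "a \<in> A" "ends G f = {u, a}"
      by (rule bipartition_other_end[OF bipartition_sym[OF bp] f(1) uB f(2)])
    then have "a \<noteq> v" using vf by auto
    then show ?thesis using a f by (auto simp: insert_commute)
  qed
  have mc: "matching_covered ?H \<longleftrightarrow> matching_covered G"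
  proof -
    have "\<exists>a\<in>A - {v}. adj G a u" if "u \<in> neighbours G v" for u
      using other[OF that, of e1] by (auto simp: adj_def)
    then show ?thesis
      unfolding matching_covered_iff_surplus[OF bpH cA(1)] matching_covered_iff_surplus[OF bp cA(2)]
      by (rule surplus_bicontraction[OF bp v(1) cN A])
  qed
  have del: "matching_covered (delete_edge ?H e) \<longleftrightarrow> matching_covered (delete_edge G e)"
    if ve: "v \<notin> ends G e" for e
  proof -
    let ?G = "delete_edge G e"
    note n = neighbours_delete_edge[OF ve] and b = bicontraction_delete_edge[OF ve]
    have bp1: "bipartition ?G A B" by (rule bipartition_delete_edge[OF bp])
    have bp2: "bipartition (bicontraction ?G v) ?A ?B" unfolding b by (rule bipartition_delete_edge[OF bpH])
    have "\<exists>a\<in>A - {v}. adj ?G a u" if "u \<in> neighbours ?G v" for u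
    proof -
      have "u \<in> neighbours G v" using that n by simp
      then obtain a f where "a \<in> A - {v}" "f \<in> edges G" "f \<noteq> e" "ends G f = {a, u}" using other by blast
      then show ?thesis by (auto simp: adj_def)
    qed
    then show ?thesis
      unfolding b[symmetric] matching_covered_iff_surplus[OF bp2 cA(1)] matching_covered_iff_surplus[OF bp1 cA(2)]
      using surplus_bicontraction[OF bp1 v(1) _ A] cN n by simp
  qed
  have at_v: "\<not> matching_covered (delete_edge G e)" if e: "e \<in> edges G" "v \<in> ends G e" for e
  proof
    assume mc': "matching_covered (delete_edge G e)"
    have bp1: "bipartition (delete_edge G e) A B" by (rule bipartition_delete_edge[OF bp])
    have "v \<in> verts (delete_edge G e)" using v(2) by (simp add: bicontractible_def)
    then have "degree (delete_edge G e) v \<ge> 2" by (rule matching_covered_degree_ge_2[OF bp1 mc'])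
    moreover have "{f \<in> edges (delete_edge G e). v \<in> ends (delete_edge G e) f} = {f \<in> edges G. v \<in> ends G f} - {e}"
      by auto
    then have "degree (delete_edge G e) v = card ({f \<in> edges G. v \<in> ends G f} - {e})"
      unfolding degree_eq[OF bp1] by simp
    moreover have "\<dots> < card {f \<in> edges G. v \<in> ends G f}"
      using fin e by (intro card_Diff1_less) auto
    moreover have "card {f \<in> edges G. v \<in> ends G f} = 2"
      using v(2) degree_eq[OF bp, of v] by (simp add: bicontractible_def)
    ultimately show False by linarith
  qed
  have "edges ?H = {e \<in> edges G. v \<notin> ends G e}" by (simp add: bicontraction_def)
  then show ?thesis
    unfolding minimal_matching_covered_def using mc del at_v by auto
qed

lemma bipartition_of_bicontraction:
  assumes fin: "finite (verts G)" "finite (edges G)"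
    and ends: "\<And>e. e \<in> edges G \<Longrightarrow> ends G e \<subseteq> verts G \<and> card (ends G e) \<le> 2"
    and v: "bicontractible G v" and bpH: "bipartition (bicontraction G v) A B" and vB: "v \<in> B"
  shows "bipartition G (insert v A) (B - {v} \<union> neighbours G v)"
proof -
  let ?N = "neighbours G v"
  have vs: "A \<union> B = verts G - ?N" and dis: "A \<inter> B = {}"
    using bpH by (auto simp: bipartition_def bicontraction_def)
  have vV: "v \<in> verts G" using v by (simp add: bicontractible_def)
  obtain v1 v2 e1 e2 where ve: "v1 \<noteq> v2" "?N = {v1, v2}" "v1 \<noteq> v" "v2 \<noteq> v" "e1 \<noteq> e2"
    "ends G e1 = {v, v1}" "ends G e2 = {v, v2}" "{e \<in> edges G. v \<in> ends G e} = {e1, e2}"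
    by (rule bicontractible_edges[OF fin(2) v])
  have "e1 \<in> edges G" "e2 \<in> edges G" using ve(8) by blast+
  then have NV: "?N \<subseteq> verts G" using ends[of e1] ends[of e2] ve by auto
  have vN: "v \<notin> ?N" using ve by auto
  have "\<exists>a\<in>insert v A. \<exists>b\<in>B - {v} \<union> ?N. ends G e = {a, b}" if e: "e \<in> edges G" for e
  proof (cases "v \<in> ends G e")
    case True
    then have "e = e1 \<or> e = e2" using ve(8) e by blast
    then show ?thesis using ve by auto
  next
    case False
    let ?\<phi> = "\<lambda>x. if x \<in> ?N then v else x"
    have "e \<in> edges (bicontraction G v)" using e False by (simp add: bicontraction_def)
    then obtain a b where ab: "a \<in> A" "b \<in> B" "ends (bicontraction G v) e = {a, b}" "a \<noteq> b"
      by (rule bipartition_ends[OF bpH])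
    then have im: "?\<phi> ` ends G e = {a, b}" by (simp add: bicontraction_def)
    have av: "a \<noteq> v" using ab vB dis by blast
    have "a \<in> ?\<phi> ` ends G e" using im by simp
    then have aE: "a \<in> ends G e" using av by (auto split: if_splits)
    have "b \<in> ?\<phi> ` ends G e" using im by simp
    then obtain c where c: "c \<in> ends G e" "b = ?\<phi> c" by blast
    have cB: "c \<in> B - {v} \<union> ?N" using c ab(2) False by (auto split: if_splits)
    have "c \<noteq> a" using cB ab(1) vs dis by auto
    have "{a, c} = ends G e"
    proof (rule card_seteq)
      show "finite (ends G e)" using ends[OF e] fin(1) finite_subset by blast
      show "{a, c} \<subseteq> ends G e" using aE c by simp
      show "card (ends G e) \<le> card {a, c}" using ends[OF e] \<open>c \<noteq> a\<close> by auto
    qed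
    then show ?thesis using ab(1) cB by (metis insertI2)
  qed
  moreover have "insert v A \<union> (B - {v} \<union> ?N) = verts G" using vs vV NV by blast
  moreover have "insert v A \<inter> (B - {v} \<union> ?N) = {}" using vs dis vN by blast
  ultimately show ?thesis using fin unfolding bipartition_def by blast
qed

section \<open>Sequences of restricted bicontractions\<close>

lemma minimal_bipartite_bipartition:
  "minimal_bipartite_matching_covered G \<longleftrightarrow> minimal_matching_covered G \<and> (\<exists>A B. bipartition G A B)"
  unfolding minimal_bipartite_matching_covered_def
  using bipartite_iff by (auto simp: minimal_matching_covered_def matching_covered_def)

lemma restricted_bicontraction_minimal:
  assumes mn: "minimal_bipartite_matching_covered G" and v: "bicontractible G v"
    and big: "\<And>u. u \<in> neighbours G v \<Longrightarrow> degree G u \<ge> 3"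
  obtains A B where "bipartition G A B" "v \<in> A"
    "bipartition (bicontraction G v) (A - {v}) (insert v (B - neighbours G v))"
    "minimal_matching_covered (bicontraction G v)"
proof -
  have mG: "minimal_matching_covered G" and "\<exists>A B. bipartition G A B"
    using mn by (simp_all add: minimal_bipartite_bipartition)
  then obtain A0 B0 where "bipartition G A0 B0" by blast
  moreover have "v \<in> verts G" using v by (simp add: bicontractible_def)
  ultimately obtain A B where bp: "bipartition G A B" and vA: "v \<in> A"
    using bipartition_sym by (metis UnE bipartition_def)
  \<comment> \<open>A neighbour of \<open>v\<close> has degree at least three and there are no
    parallel edges, which gives the three vertices in \<open>A\<close>.\<close>
  have "neighbours G v \<noteq> {}" using v by (auto simp: bicontractible_def)
  then obtain u where u: "u \<in> neighbours G v" by blast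
  then have "u \<in> B" using nbhd_subset[OF bp, of "{v}"] vA neighbours_eq_nbhd[OF bp] by auto
  then have "nbhd G {u} \<subseteq> A" using nbhd_subset[OF bipartition_sym[OF bp]] by simp
  then have "card (nbhd G {u}) \<le> card A" using bipartition_finite[OF bp] by (simp add: card_mono)
  then have "card A \<ge> 3" using big[OF u] minimal_degree[OF bp mG, of u] by simp
  then have "minimal_matching_covered (bicontraction G v)"
    using minimal_bicontraction[OF bp vA v _ big] mG by blast
  then show thesis using that[OF bp vA bipartition_bicontraction[OF bp vA]] by blast
qed

text \<open>The neighbours of \<open>v\<close> are big, the merged vertex is big, and all other
  degrees are unchanged. So \<open>v\<close> is the only 2-vertex lost, and 2-edges meet neither
  \<open>v\<close> nor its neighbours. The union of their end sets is recorded because together with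
  \<open>two_verts\<close> it determines \<open>isolated_twos\<close>.\<close>

lemma bicontraction_numbers:
  assumes mn: "minimal_bipartite_matching_covered G" and v: "bicontractible G v"
    and big: "\<And>u. u \<in> neighbours G v \<Longrightarrow> degree G u \<ge> 3"
  shows "card (verts G) = card (verts (bicontraction G v)) + 2"
    and "card (edges G) = card (edges (bicontraction G v)) + 2"
    and "two_verts G = insert v (two_verts (bicontraction G v))" "v \<notin> two_verts (bicontraction G v)"
    and "two_edges (bicontraction G v) = two_edges G"
    and "\<Union>(ends (bicontraction G v) ` two_edges (bicontraction G v)) = \<Union>(ends G ` two_edges G)"
proof -
  let ?H = "bicontraction G v" and ?N = "neighbours G v"
  obtain A B where bp: "bipartition G A B" and vA: "v \<in> A"
    and bpH: "bipartition ?H (A - {v}) (insert v (B - ?N))"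
    by (rule restricted_bicontraction_minimal[OF mn v big])
  have fin: "finite (verts G)" "finite (edges G)" using bp by (auto simp: bipartition_def)
  have dis: "A \<inter> B = {}" using bp by (simp add: bipartition_def)
  have vV: "v \<in> verts G" and dv: "degree G v = 2" using v by (simp_all add: bicontractible_def)
  obtain v1 v2 e1 e2 where ve: "v1 \<noteq> v2" "?N = {v1, v2}" "v1 \<noteq> v" "v2 \<noteq> v" "e1 \<noteq> e2"
    "ends G e1 = {v, v1}" "ends G e2 = {v, v2}" "{e \<in> edges G. v \<in> ends G e} = {e1, e2}"
    by (rule bicontractible_edges[OF fin(2) v])
  have NB: "?N \<subseteq> B" unfolding neighbours_eq_nbhd[OF bp] by (rule nbhd_subset[OF bp]) (use vA in simp)
  have NV: "?N \<subseteq> verts G" using NB bp by (auto simp: bipartition_def)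
  have vsH: "verts ?H = verts G - ?N" and esH: "edges ?H = edges G - {e1, e2}"
    and endsH: "\<And>e. ends ?H e = (\<lambda>x. if x \<in> ?N then v else x) ` ends G e"
    using ve(8) by (auto simp: bicontraction_def)
  have E: "{e1, e2} \<subseteq> edges G" using ve(8) by blast
  have "card (verts ?H) = card (verts G) - 2" "card (edges ?H) = card (edges G) - 2"
    using fin NV E ve(1,2,5) by (simp_all add: vsH esH card_Diff_subset)
  moreover have "2 \<le> card (verts G)" "2 \<le> card (edges G)"
    using card_mono[OF fin(1) NV] card_mono[OF fin(2) E] ve(1,2,5) by simp_all
  ultimately show "card (verts G) = card (verts ?H) + 2" "card (edges G) = card (edges ?H) + 2" by simp_all
  have same: "degree ?H x = degree G x" if x: "x \<notin> ?N" "x \<noteq> v" for x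
  proof -
    have "{e \<in> edges ?H. x \<in> ends ?H e} = {e \<in> edges G. x \<in> ends G e}"
    proof (intro equalityI subsetI)
      fix e assume "e \<in> {e \<in> edges ?H. x \<in> ends ?H e}"
      then show "e \<in> {e \<in> edges G. x \<in> ends G e}" using x by (auto simp: esH endsH split: if_splits)
    next
      fix e assume e: "e \<in> {e \<in> edges G. x \<in> ends G e}"
      then have "e \<noteq> e1" "e \<noteq> e2" using ve x by auto
      then show "e \<in> {e \<in> edges ?H. x \<in> ends ?H e}" using e x by (force simp: esH endsH)
    qed
    then show ?thesis unfolding degree_eq[OF bp] degree_eq[OF bpH] by simp
  qed
  \<comment> \<open>Each of \<open>v1\<close> and \<open>v2\<close> contributes at least two edges
    besides the one to \<open>v\<close>, and no edge is contributed by both since both lie in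
    \<open>B\<close>.\<close>
  have dvH: "degree ?H v \<ge> 3"
  proof -
    let ?S = "\<lambda>u. {e \<in> edges G. u \<in> ends G e}"
    have "e1 \<in> ?S v1" "e2 \<in> ?S v2" using ve E by auto
    then have c: "card (?S v1 - {e1}) \<ge> 2" "card (?S v2 - {e2}) \<ge> 2"
      using big[of v1] big[of v2] ve(2) fin by (simp_all add: degree_eq[OF bp])
    have no: "\<not> (v1 \<in> ends G e \<and> v2 \<in> ends G e)" if e: "e \<in> edges G" for e
    proof
      assume w: "v1 \<in> ends G e \<and> v2 \<in> ends G e"
      obtain a b where "a \<in> A" "b \<in> B" "ends G e = {a, b}" by (rule bipartition_ends[OF bp e])
      then have "v1 = b" "v2 = b" using w NB ve(2) dis by auto
      then show False using ve(1) by simp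
    qed
    have "?S v1 - {e1} \<union> (?S v2 - {e2}) \<subseteq> {e \<in> edges ?H. v \<in> ends ?H e}"
      using ve no by (auto simp: esH endsH)
    then have "card (?S v1 - {e1} \<union> (?S v2 - {e2})) \<le> degree ?H v"
      unfolding degree_eq[OF bpH] using fin by (intro card_mono) (auto simp: esH)
    moreover have "card (?S v1 - {e1} \<union> (?S v2 - {e2})) = card (?S v1 - {e1}) + card (?S v2 - {e2})"
      using no fin by (intro card_Un_disjoint) auto
    ultimately show ?thesis using c by linarith
  qed
  show "two_verts G = insert v (two_verts ?H)"
  proof (intro equalityI subsetI)
    fix x assume x: "x \<in> two_verts G"
    then have "x \<notin> ?N" using big by (fastforce simp: two_verts_def)
    then show "x \<in> insert v (two_verts ?H)" using x same[of x] by (cases "x = v") (auto simp: two_verts_def vsH)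
  next
    fix x assume "x \<in> insert v (two_verts ?H)"
    then show "x \<in> two_verts G" using same[of x] vV dv by (cases "x = v") (auto simp: two_verts_def vsH)
  qed
  show "v \<notin> two_verts ?H" using dvH by (simp add: two_verts_def)
  have keep: "e \<in> two_edges ?H \<longleftrightarrow> e \<in> two_edges G" and
    keep_ends: "e \<in> two_edges G \<Longrightarrow> ends ?H e = ends G e" for e
  proof -
    have *: "ends ?H e = ends G e \<and> e \<in> two_edges ?H" if e: "e \<in> two_edges G"
    proof -
      have N: "ends G e \<inter> ?N = {}" using e big by (fastforce simp: two_edges_def)
      then have eq: "ends ?H e = ends G e" by (force simp: endsH)
      have "e \<noteq> e1" "e \<noteq> e2" using N ve by auto
      then have vE: "v \<notin> ends G e" using e ve(8) by (auto simp: two_edges_def)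
      have "degree ?H x = 2" if "x \<in> ends G e" for x
        using same[of x] that N vE e by (auto simp: two_edges_def)
      then show ?thesis using eq e \<open>e \<noteq> e1\<close> \<open>e \<noteq> e2\<close> by (simp add: two_edges_def esH)
    qed
    moreover have "e \<in> two_edges G" if e: "e \<in> two_edges ?H"
    proof -
      have vE: "v \<notin> ends ?H e" using e dvH by (force simp: two_edges_def)
      then have N: "ends G e \<inter> ?N = {}" "v \<notin> ends G e" by (auto simp: endsH)
      then have eq: "ends ?H e = ends G e" by (force simp: endsH)
      have "degree G x = 2" if "x \<in> ends G e" for x
        using same[of x] that N e eq by (auto simp: two_edges_def)
      then show ?thesis using e by (simp add: two_edges_def esH)
    qed
    ultimately show "e \<in> two_edges ?H \<longleftrightarrow> e \<in> two_edges G"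
      "e \<in> two_edges G \<Longrightarrow> ends ?H e = ends G e" by blast+
  qed
  show eq: "two_edges ?H = two_edges G" using keep by blast
  show "\<Union>(ends ?H ` two_edges ?H) = \<Union>(ends G ` two_edges G)"
    unfolding eq using keep_ends by simp
qed

lemma retract_numbers:
  assumes "restricted_bicontraction\<^sup>*\<^sup>* G H" and mn: "minimal_bipartite_matching_covered G"
  shows "minimal_bipartite_matching_covered H \<and> two_edges H = two_edges G \<and>
    card (\<Union>(ends H ` two_edges H)) = card (\<Union>(ends G ` two_edges G)) \<and>
    (\<exists>k. card (verts G) = card (verts H) + 2 * k \<and> card (edges G) = card (edges H) + 2 * k \<and>
      card (two_verts G) = card (two_verts H) + k)"
  using assms(1)
proof induction
  case base
  show ?case using mn by (auto intro!: exI[of _ 0])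
next
  case (step K L)
  from step.hyps(2) obtain v where v: "bicontractible K v" "\<And>u. u \<in> neighbours K v \<Longrightarrow> degree K u \<ge> 3"
    and L: "L = bicontraction K v"
    unfolding restricted_bicontraction_def by blast
  have mnK: "minimal_bipartite_matching_covered K" using step.IH by blast
  obtain k where k: "card (verts G) = card (verts K) + 2 * k" "card (edges G) = card (edges K) + 2 * k"
    "card (two_verts G) = card (two_verts K) + k" using step.IH by blast
  note num = bicontraction_numbers[OF mnK v, folded L]
  obtain A B where "bipartition L A B" "minimal_matching_covered L"
    using restricted_bicontraction_minimal[OF mnK v] L by metis
  then have mnL: "minimal_bipartite_matching_covered L" by (auto simp: minimal_bipartite_bipartition)
  then have "finite (verts L)" by (auto simp: minimal_bipartite_bipartition bipartition_def)
  then have "finite (two_verts L)" by (simp add: two_verts_def)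
  then have "card (two_verts K) = Suc (card (two_verts L))" using num(3,4) by simp
  then have "card (verts G) = card (verts L) + 2 * Suc k" "card (edges G) = card (edges L) + 2 * Suc k"
    "card (two_verts G) = card (two_verts L) + Suc k"
    using k num(1,2) by simp_all
  moreover have "two_edges L = two_edges G" using num(5) step.IH by simp
  moreover have "card (\<Union>(ends L ` two_edges L)) = card (\<Union>(ends G ` two_edges G))" using num(6) conjunct1[OF conjunct2[OF conjunct2[OF step.IH]]] by (simp only:)
  ultimately show ?case using mnL by blast
qed

text \<open>The induction peels off the first contraction and carries only what contraction
  preserves without further knowledge: finiteness and end sets of at most two vertices.
  Bipartiteness and minimality are lifted step by step from \<open>H\<close>.\<close>

lemma retract_minimal_backward:
  assumes "restricted_bicontraction\<^sup>*\<^sup>* G H" and mn: "minimal_bipartite_matching_covered H"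
    and "finite (verts G)" "finite (edges G)"
    and "\<And>e. e \<in> edges G \<Longrightarrow> ends G e \<subseteq> verts G \<and> card (ends G e) \<le> 2"
  shows "minimal_bipartite_matching_covered G"
  using assms(1,3-)
proof (induction rule: converse_rtranclp_induct)
  case base
  show ?case by (rule mn)
next
  case (step G K)
  from step.hyps(1) obtain v where v: "bicontractible G v" and big: "\<And>u. u \<in> neighbours G v \<Longrightarrow> degree G u \<ge> 3"
    and K: "K = bicontraction G v"
    unfolding restricted_bicontraction_def by blast
  have vV: "v \<in> verts G" and vN: "v \<notin> neighbours G v"
    using v by (auto simp: bicontractible_def neighbours_def)
  have mnK: "minimal_bipartite_matching_covered K"
  proof (rule step.IH)
    show "finite (verts K)" "finite (edges K)" using step.prems by (simp_all add: K bicontraction_def)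
    fix e assume "e \<in> edges K"
    then have e: "ends G e \<subseteq> verts G" "card (ends G e) \<le> 2"
      using step.prems(3)[of e] by (auto simp: K bicontraction_def)
    have "finite (ends G e)" using e(1) step.prems(1) finite_subset by blast
    moreover have "ends K e = (\<lambda>x. if x \<in> neighbours G v then v else x) ` ends G e"
      unfolding K bicontraction_def by simp
    ultimately have "card (ends K e) \<le> card (ends G e)" using card_image_le by metis
    then show "ends K e \<subseteq> verts K \<and> card (ends K e) \<le> 2"
      using e vV vN by (auto simp: K bicontraction_def)
  qed
  then obtain A0 B0 where bp0: "bipartition K A0 B0" and mK: "minimal_matching_covered K"
    by (auto simp: minimal_bipartite_bipartition)
  have "v \<in> verts K" using vV vN by (simp add: K bicontraction_def)
  then obtain A B where bpK: "bipartition K A B" and vB: "v \<in> B"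
    using bp0 bipartition_sym by (metis UnE bipartition_def)
  let ?A = "insert v A"
  have bp: "bipartition G ?A (B - {v} \<union> neighbours G v)"
    by (rule bipartition_of_bicontraction[OF step.prems v bpK[unfolded K] vB])
  have dis: "A \<inter> B = {}" and vs: "verts K = A \<union> B" using bpK by (auto simp: bipartition_def)
  have fin: "finite A" "finite B" using bipartition_finite[OF bpK] .
  have mcK: "matching_covered K" using mK by (simp add: minimal_matching_covered_def)
  have "card A = card B" using matching_covered_surplus[OF bpK mcK] by (simp add: surplus_def)
  moreover have "card A + card B \<ge> 4"
    using mcK vs dis fin by (simp add: matching_covered_def card_Un_disjoint)
  \<comment> \<open>Two vertices come from the class \<open>A\<close> of \<open>K\<close>, which has
    at least four vertices in all; the third is \<open>v\<close>.\<close>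
  ultimately have "card ?A \<ge> 3" using vB dis fin by (auto simp: card_insert_if)
  then have "minimal_matching_covered G"
    using minimal_bicontraction[OF bp _ v _ big] mK K by blast
  then show ?case using bp by (auto simp: minimal_bipartite_bipartition)
qed

section \<open>The bounds and the case of equality\<close>

lemma minimal_bounds:
  assumes mn: "minimal_bipartite_matching_covered G"
  shows "card (verts G) \<ge> 4"
    and "card (verts G) = card (two_verts G) + card {v \<in> verts G. degree G v \<ge> 3}"
    and "card (two_verts G) = card (isolated_twos G) + card (\<Union>(ends G ` two_edges G))"
    and "card (\<Union>(ends G ` two_edges G)) \<le> 2 * card (two_edges G)"
    and "card {v \<in> verts G. degree G v \<ge> 3} > 0 \<Longrightarrow>
      card (isolated_twos G) + 2 \<le> card {v \<in> verts G. degree G v \<ge> 3}"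
    and "card {v \<in> verts G. degree G v \<ge> 3} > 0 \<Longrightarrow>
      card (edges G) + card (two_edges G) + 2 \<le> card {v \<in> verts G. degree G v \<ge> 3} + 2 * card (two_verts G)"
    and "card {v \<in> verts G. degree G v \<ge> 3} = 0 \<Longrightarrow>
      card (edges G) = card (verts G) \<and> card (two_edges G) = card (verts G)"
    and "2 * card (edges G) = 2 * card (two_verts G) + (\<Sum>v | v \<in> verts G \<and> degree G v \<ge> 3. degree G v)"
proof -
  obtain A B where bp: "bipartition G A B" and mG: "minimal_matching_covered G"
    using mn by (auto simp: minimal_bipartite_bipartition)
  have mc: "matching_covered G" using mG by (simp add: minimal_matching_covered_def)
  show "card (verts G) \<ge> 4" using mc by (simp add: matching_covered_def)
  let ?V = "{v \<in> verts G. degree G v \<ge> 3}"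
  have fin: "finite (verts G)" "finite (edges G)" using bp by (auto simp: bipartition_def)
  have fin2: "finite (two_verts G)" "finite ?V" using fin by (simp_all add: two_verts_def)
  have "v \<in> two_verts G \<union> ?V" if "v \<in> verts G" for v
    using matching_covered_degree_ge_2[OF bp mc that] that by (auto simp: two_verts_def)
  then have split: "verts G = two_verts G \<union> ?V" by (auto simp: two_verts_def)
  have dis: "two_verts G \<inter> ?V = {}" by (auto simp: two_verts_def)
  show n: "card (verts G) = card (two_verts G) + card ?V"
    using card_Un_disjoint[OF fin2 dis] split by simp
  have gr: "graph G" by (rule bipartition_graph[OF bp])
  have D: "\<Union>(ends G ` two_edges G) \<subseteq> two_verts G"
    using gr by (auto simp: two_edges_def two_verts_def graph_def)
  show "card (two_verts G) = card (isolated_twos G) + card (\<Union>(ends G ` two_edges G))"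
    unfolding isolated_twos_def using card_Int_Diff[OF fin2(1)] by (metis D Int_absorb1 add.commute)
  have "card (\<Union>(ends G ` two_edges G)) \<le> (\<Sum>e\<in>two_edges G. card (ends G e))"
    by (rule card_UN_le) (use fin in \<open>simp add: two_edges_def\<close>)
  also have "\<dots> = (\<Sum>e\<in>two_edges G. 2)"
    by (rule sum.cong) (use gr in \<open>auto simp: two_edges_def graph_def\<close>)
  finally show "card (\<Union>(ends G ` two_edges G)) \<le> 2 * card (two_edges G)" by simp
  note count = card_edges_two_verts[OF bp mc]
  have sum: "2 * card (edges G) = (\<Sum>v\<in>two_verts G. degree G v) + (\<Sum>v\<in>?V. degree G v)"
    using sum_degree_verts[OF bp] sum.union_disjoint[OF fin2 dis, of "degree G"] split by simp
  moreover have "(\<Sum>v\<in>two_verts G. degree G v) = (\<Sum>v\<in>two_verts G. 2)"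
    by (rule sum.cong) (auto simp: two_verts_def)
  ultimately show eq: "2 * card (edges G) = 2 * card (two_verts G) + (\<Sum>v\<in>?V. degree G v)" by simp
  show "card (isolated_twos G) + 2 \<le> card ?V" if "card ?V > 0"
  proof -
    have "?V \<noteq> {}" using that unfolding card_gt_0_iff by (rule conjunct1)
    then obtain v where "v \<in> ?V" by blast
    then show ?thesis using card_isolated_twos[OF bp mc] by blast
  qed
  show "card (edges G) + card (two_edges G) + 2 \<le> card ?V + 2 * card (two_verts G)" if "card ?V > 0"
  proof -
    have "?V \<noteq> {}" using that unfolding card_gt_0_iff by (rule conjunct1)
    then obtain v where "v \<in> ?V" by blast
    then have "card (big_edges G) + 2 \<le> card ?V" using card_big_edges[OF bp mG] by blast
    then show ?thesis using count by linarith
  qed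
  \<comment> \<open>Without big vertices the graph is 2-regular: the two preceding bounds fail, and
    every edge is a 2-edge.\<close>
  show "card (edges G) = card (verts G) \<and> card (two_edges G) = card (verts G)" if "card ?V = 0"
  proof -
    have V: "?V = {}" using that fin2(2) by (simp only: card_eq_0_iff) simp
    have "big_edges G = {}"
    proof (rule ccontr)
      assume "big_edges G \<noteq> {}"
      then obtain e where e: "e \<in> edges G" "\<forall>v\<in>ends G e. degree G v \<ge> 3" by (auto simp: big_edges_def)
      obtain a b where "a \<in> A" "ends G e = {a, b}" by (rule bipartition_ends[OF bp e(1)])
      then have "a \<in> ?V" using e bp by (auto simp: bipartition_def)
      then show False using V by blast
    qed
    then have "card (big_edges G) = 0" by simp
    moreover have "(\<Sum>v\<in>?V. degree G v) = 0" unfolding V by simp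
    ultimately show ?thesis using count eq n that by linarith
  qed
qed

lemma sum_big_degrees:
  assumes fin: "finite (verts G)"
  shows "(\<Sum>v | v \<in> verts G \<and> degree G v \<ge> 3. degree G v) \<ge> 3 * card {v \<in> verts G. degree G v \<ge> 3}"
    and "(\<Sum>v | v \<in> verts G \<and> degree G v \<ge> 3. degree G v) = 3 * card {v \<in> verts G. degree G v \<ge> 3} \<longleftrightarrow>
      (\<forall>v\<in>verts G. degree G v \<le> 3)"
proof -
  let ?V = "{v \<in> verts G. degree G v \<ge> 3}"
  \<comment> \<open>No truncation occurs, as only degrees of at least three are summed; equality
    means that every excess \<open>degree G v - 3\<close> vanishes.\<close>
  have "(\<Sum>v\<in>?V. degree G v) = (\<Sum>v\<in>?V. 3 + (degree G v - 3))" by (rule sum.cong) auto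
  also have "\<dots> = 3 * card ?V + (\<Sum>v\<in>?V. degree G v - 3)"
    unfolding sum.distrib sum_constant by simp
  finally have s: "(\<Sum>v\<in>?V. degree G v) = 3 * card ?V + (\<Sum>v\<in>?V. degree G v - 3)" .
  then show "(\<Sum>v\<in>?V. degree G v) \<ge> 3 * card ?V" by simp
  have "(\<Sum>v\<in>?V. degree G v) = 3 * card ?V \<longleftrightarrow> (\<forall>v\<in>?V. degree G v - 3 = 0)"
    unfolding s using fin by (simp add: sum_eq_0_iff)
  also have "\<dots> \<longleftrightarrow> (\<forall>v\<in>verts G. degree G v \<le> 3)"
    using nat_le_linear by (simp only: diff_is_0_eq) blast
  finally show "(\<Sum>v\<in>?V. degree G v) = 3 * card ?V \<longleftrightarrow> (\<forall>v\<in>verts G. degree G v \<le> 3)" .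
qed

lemma max_degree_3_iff:
  assumes "finite (verts G)" "verts G \<noteq> {}"
  shows "max_degree G = 3 \<longleftrightarrow>
    (\<forall>v\<in>verts G. degree G v \<le> 3) \<and> card {v \<in> verts G. degree G v \<ge> 3} > 0"
proof -
  have "max_degree G = 3 \<longleftrightarrow> 3 \<in> degree G ` verts G \<and> (\<forall>d\<in>degree G ` verts G. d \<le> 3)"
    unfolding max_degree_def using assms by (intro Max_eq_iff) auto
  moreover have "card {v \<in> verts G. degree G v \<ge> 3} > 0 \<longleftrightarrow> (\<exists>v\<in>verts G. degree G v \<ge> 3)"
    using assms by (auto simp: card_gt_0_iff)
  moreover have "3 \<in> degree G ` verts G \<and> (\<forall>d\<in>degree G ` verts G. d \<le> 3) \<longleftrightarrow>
      (\<forall>v\<in>verts G. degree G v \<le> 3) \<and> (\<exists>v\<in>verts G. degree G v \<ge> 3)"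
  proof (intro iffI conjI)
    assume "3 \<in> degree G ` verts G \<and> (\<forall>d\<in>degree G ` verts G. d \<le> 3)"
    then show "\<forall>v\<in>verts G. degree G v \<le> 3" "\<exists>v\<in>verts G. degree G v \<ge> 3"
      by (blast, metis image_iff order_refl)
  next
    assume *: "(\<forall>v\<in>verts G. degree G v \<le> 3) \<and> (\<exists>v\<in>verts G. degree G v \<ge> 3)"
    then show "\<forall>d\<in>degree G ` verts G. d \<le> 3" by blast
    from * obtain v where "v \<in> verts G" "degree G v = 3" using antisym by blast
    then show "3 \<in> degree G ` verts G" by force
  qed
  ultimately show ?thesis by simp
qed

text \<open>Such a vertex has two distinct neighbours, since minimal graphs have no parallel edges,
  and both are big, so one more contraction would be possible.\<close>

lemma irreducible_isolated_twos:
  assumes mn: "minimal_bipartite_matching_covered H" and "\<nexists>K. restricted_bicontraction H K"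
  shows "isolated_twos H = {}"
proof (rule ccontr)
  assume "isolated_twos H \<noteq> {}"
  then obtain v where v: "v \<in> isolated_twos H" by blast
  obtain A B where bp: "bipartition H A B" and mH: "minimal_matching_covered H"
    using mn by (auto simp: minimal_bipartite_bipartition)
  have mc: "matching_covered H" using mH by (simp add: minimal_matching_covered_def)
  have "v \<in> verts H" "degree H v = 2" using v by (auto simp: isolated_twos_def two_verts_def)
  then have "bicontractible H v"
    using minimal_degree[OF bp mH, of v] neighbours_eq_nbhd[OF bp, of v] by (simp add: bicontractible_def)
  moreover have "\<forall>u\<in>neighbours H v. degree H u \<ge> 3"
    using isolated_twos_neighbour[OF bp mc v] by (auto simp: neighbours_def)
  ultimately show False using assms(2) by (auto simp: restricted_bicontraction_def)
qed

theorem theorem1p10: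
  fixes G H :: "('v, 'e) multigraph"
  assumes "graph G" and "partial_retract G H"
  shows "two_edge_extremal_mbmc G \<longleftrightarrow> edge_extremal_mbmc H \<and> max_degree G = 3"
proof -
  have GH: "restricted_bicontraction\<^sup>*\<^sup>* G H" and irr: "\<nexists>K. restricted_bicontraction H K"
    using assms(2) by (auto simp: partial_retract_def)
  have "minimal_bipartite_matching_covered G" if "minimal_bipartite_matching_covered H"
    by (rule retract_minimal_backward[OF GH that]) (use assms(1) in \<open>auto simp: graph_def\<close>)
  then have iff: "minimal_bipartite_matching_covered H \<longleftrightarrow> minimal_bipartite_matching_covered G"
    using retract_numbers[OF GH] by blast
  show ?thesis
  proof (cases "minimal_bipartite_matching_covered G")
    case False
    then show ?thesis using iff by (simp add: two_edge_extremal_mbmc_def edge_extremal_mbmc_def)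
  next
    case mnG: True
    then have mnH: "minimal_bipartite_matching_covered H" using iff by simp
    define n n2 b i d e m s where "n = card (verts G)" and "n2 = card (two_verts G)"
      and "b = card {v \<in> verts G. degree G v \<ge> 3}" and "i = card (isolated_twos G)"
      and "d = card (\<Union>(ends G ` two_edges G))" and "e = card (two_edges G)" and "m = card (edges G)"
      and "s = (\<Sum>v | v \<in> verts G \<and> degree G v \<ge> 3. degree G v)"
    note defs = n_def n2_def b_def i_def d_def e_def m_def s_def
    note bG = minimal_bounds[OF mnG, folded defs] and bH = minimal_bounds[OF mnH]
    have i': "card (isolated_twos H) = 0" by (simp add: irreducible_isolated_twos[OF mnH irr])
    obtain k where te: "two_edges H = two_edges G"
      and d': "card (\<Union>(ends H ` two_edges H)) = d"
      and k: "n = card (verts H) + 2 * k" "m = card (edges H) + 2 * k" "n2 = card (two_verts H) + k"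
      using retract_numbers[OF GH mnG] unfolding defs by blast
    define b' where "b' = card {v \<in> verts H. degree H v \<ge> 3}"
    have e': "card (two_edges H) = e" by (simp add: te e_def)
    note bH' = bH[folded b'_def, unfolded i' d' e']
    have fin: "finite (verts G)" and ne: "verts G \<noteq> {}" using assms(1) bG(1) by (auto simp: graph_def n_def)
    have s3: "s \<ge> 3 * b" "s = 3 * b \<longleftrightarrow> (\<forall>v\<in>verts G. degree G v \<le> 3)"
      using sum_big_degrees[OF fin] by (simp_all add: defs)
    have max: "max_degree G = 3 \<longleftrightarrow> s = 3 * b \<and> b > 0"
      using max_degree_3_iff[OF fin ne] s3(2) by (simp add: b_def)
    have "two_edge_extremal_mbmc G \<longleftrightarrow> real e = (real n + 10) / 6"
      using mnG by (simp add: two_edge_extremal_mbmc_def defs)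
    also have "\<dots> \<longleftrightarrow> real (6 * e) = real (n + 10)" by (simp add: field_simps)
    also have "\<dots> \<longleftrightarrow> 6 * e = n + 10" by (rule of_nat_eq_iff)
    finally have 1: "two_edge_extremal_mbmc G \<longleftrightarrow> 6 * e = n + 10" .
    have "edge_extremal_mbmc H \<longleftrightarrow> real (card (edges H)) = (3 * real (card (verts H)) - 6) / 2"
      using mnH by (simp add: edge_extremal_mbmc_def)
    also have "\<dots> \<longleftrightarrow> real (2 * card (edges H) + 6) = real (3 * card (verts H))" by (auto simp: field_simps)
    also have "\<dots> \<longleftrightarrow> 2 * card (edges H) + 6 = 3 * card (verts H)" by (rule of_nat_eq_iff)
    finally have 2: "edge_extremal_mbmc H \<longleftrightarrow> 2 * card (edges H) + 6 = 3 * card (verts H)" .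
    \<comment> \<open>Each contraction removes one 2-vertex and one big vertex and keeps the 2-edges
      with their ends. As no isolated 2-vertex is left in \<open>H\<close>, there are exactly
      \<open>i\<close> contractions.\<close>
    have bb: "b' + i = b" and ki: "k = i" using bG(2,3) bH'(2,3) k by linarith+
    show ?thesis
    proof (cases "b = 0")
      case True
      \<comment> \<open>Here \<open>6 * n = n + 10\<close> would mean \<open>n = 2\<close>, below
        the required four vertices, and the maximum degree is not three either.\<close>
      then have "e = n" using bG(7) by simp
      then have "6 * e \<noteq> n + 10" using bG(1) by linarith
      then show ?thesis using 1 max True by simp
    next
      case False
      then have i2: "i + 2 \<le> b" using bG(5) by simp
      then have "b' > 0" using bb by linarith
      then have f: "card (edges H) + e + 2 \<le> b' + 2 * card (two_verts H)" using bH'(6) by simp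
      note facts = f i2 bb ki k bG(2,3,4,8) bH'(2,3,4) s3(1)
      \<comment> \<open>Doubling \<open>f\<close> and inserting
        \<open>2 * card (edges H) + 2 * i = 2 * d + s\<close> gives
        \<open>b + 2 * e + 4 \<le> 2 * d\<close> by \<open>s \<ge> 3 * b\<close>. With
        \<open>d \<le> 2 * e\<close> this yields \<open>b + 4 \<le> 2 * e\<close>, so
        \<open>n = d + b + i \<le> 2 * e + 2 * b - 2 \<le> 6 * e - 10\<close>. Equality forces
        \<open>s = 3 * b\<close>, \<open>d = 2 * e\<close> and \<open>b' = 2\<close>. Conversely,
        edge extremality of \<open>H\<close> and \<open>s = 3 * b\<close> give
        \<open>d = i + 6\<close>; then \<open>b + 4 \<le> d\<close> forces \<open>b = i + 2\<close>
        and \<open>d = 2 * e\<close>.\<close>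
      have "6 * e = n + 10 \<longleftrightarrow> 2 * card (edges H) + 6 = 3 * card (verts H) \<and> s = 3 * b"
        using facts by linarith
      then show ?thesis using 1 2 max False by simp
    qed
  qed
qed

end
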